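(* Let $(\mathcal{A},L)$ be a compact quantum metric space and let $\tau$ be a faithful trace on $\mathcal{A}$. If $\mathcal{A}$ is finite dimensional, then the Bures metric $d_B^\tau$ and the quantum metric $d_L^\tau$ on $D_\tau(\mathcal{A})$ are topologically equivalent.
   Context: A compact quantum metric space is a pair $(\mathcal{A},L)$ where $\mathcal{A}$ is a unital C*-algebra and $L:\mathcal{A}\to[0,\infty]$ is a seminorm such that: (1) $\{a\in\mathcal{A}: L(a)<\infty\}$ is dense in $\mathcal{A}$; (2) $L(a)=0$ if and only if $a\in\mathbb{C}1_{\mathcal{A}}$; (3) $L(a)=L(a^* )$ for all $a\in\mathcal{A}$; (4) the Monge–Kantorovich metric, defined for $\varphi,\psi$ in the state space $S(\mathcal{A})$ by $mk_L(\varphi,\psi)=\sup\{|\varphi(a)-\psi(a)| : a\in\mathcal{A},\ L(a)\leq 1\}$, metrizes the weak* topology on $S(\mathcal{A})$. A faithful trace $\tau$ is a positive linear functional with $\tau(ab)=\tau(ba)$ for all $a,b$, and $\tau(a^*a)=0$ only if $a=0$ (not necessarily of norm $1$). The density space is $D_\tau(\mathcal{A})=\{a\in\mathcal{A}_+:\tau(a)=1\}$, where $\mathcal{A}_+$ is the set of positive elements. For $a\in D_\tau(\mathcal{A})$, $\varphi_a^\tau$ is the state $\varphi_a^\tau(b)=\tau(ab)$, $b\in\mathcal{A}$. The quantum metric on $D_\tau(\mathcal{A})$ is $d_L^\tau(x,y)=mk_L(\varphi_x^\tau,\varphi_y^\tau)$ (a metric, since $a\mapsto\varphi_a^\tau$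 is an injective map $D_\tau(\mathcal{A})\to S(\mathcal{A})$). The Bures metric on $D_\tau(\mathcal{A})$ is $d_B^\tau(x,y)=\sqrt{1-\tau(|\sqrt{x}\sqrt{y}|)}$, where $\sqrt{\cdot}$ is the positive square root and $|a|=\sqrt{a^*a}$; it is known (Farenick–Rahaman) that $d_B^\tau$ is a metric. Two metrics on a set are topologically equivalent if they induce the same topology. *)

theory Defs
  imports "HOL-Analysis.Analysis"
begin

text \<open>
  Unital C*-algebras over the complex numbers. The real normed algebra structure of the
  superclasses is the restriction of scalars of the complex one. The class
  \<^class>\<open>real_normed_algebra_1\<close> imposes \<open>1 \<noteq> 0\<close>, so only the zero algebra (which has no states)
  is excluded; \<open>norm 1 = 1\<close> is then a consequence of the C*-identity.
\<close>

class cstar_algebra = real_normed_algebra_1 + banach +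
  fixes scaleC :: "complex \<Rightarrow> 'a \<Rightarrow> 'a"  (infixr \<open>*\<^sub>C\<close> 75)
    and star :: "'a \<Rightarrow> 'a"
  assumes scaleC_add_right: "c *\<^sub>C (x + y) = c *\<^sub>C x + c *\<^sub>C y"
    and scaleC_add_left: "(c + d) *\<^sub>C x = c *\<^sub>C x + d *\<^sub>C x"
    and scaleC_scaleC: "c *\<^sub>C (d *\<^sub>C x) = (c * d) *\<^sub>C x"
    and scaleC_of_real: "complex_of_real r *\<^sub>C x = r *\<^sub>R x"
    and mult_scaleC_left: "(c *\<^sub>C x) * y = c *\<^sub>C (x * y)"
    and mult_scaleC_right: "x * (c *\<^sub>C y) = c *\<^sub>C (x * y)"
    and norm_scaleC: "norm (c *\<^sub>C x) = cmod c * norm x"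
    and star_add: "star (x + y) = star x + star y"
    and star_scaleC: "star (c *\<^sub>C x) = cnj c *\<^sub>C star x"
    and star_mult: "star (x * y) = star y * star x"
    and star_star: "star (star x) = x"
    and cstar_identity: "norm (star x * x) = (norm x)\<^sup>2"

lemma vector_space_scaleC: "vector_space (scaleC :: complex \<Rightarrow> 'a::cstar_algebra \<Rightarrow> 'a)"
  using scaleC_of_real[of 1]
  by unfold_locales (simp_all add: scaleC_add_right scaleC_add_left scaleC_scaleC)

definition spectrum :: "'a::cstar_algebra \<Rightarrow> complex set" where
  "spectrum a = {z. \<not> (\<exists>b. (a - z *\<^sub>C 1) * b = 1 \<and> b * (a - z *\<^sub>C 1) = 1)}"

definition positive :: "'a::cstar_algebra \<Rightarrow> bool" where
  "positive a \<longleftrightarrow> star a = a \<and> spectrum a \<subseteq> \<real>\<^sub>\<ge>\<^sub>0"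

text \<open>Meaningful for positive arguments, which have exactly one positive square root.\<close>

definition cstar_sqrt :: "'a::cstar_algebra \<Rightarrow> 'a" where
  "cstar_sqrt a = (THE b. positive b \<and> b * b = a)"

definition cstar_abs :: "'a::cstar_algebra \<Rightarrow> 'a" where
  "cstar_abs a = cstar_sqrt (star a * a)"

definition positive_functional :: "('a::cstar_algebra \<Rightarrow> complex) \<Rightarrow> bool" where
  "positive_functional \<phi> \<longleftrightarrow>
     Vector_Spaces.linear scaleC (*) \<phi> \<and> (\<forall>a. positive a \<longrightarrow> \<phi> a \<in> \<real>\<^sub>\<ge>\<^sub>0)"

text \<open>
  Positive linear functionals are automatically bounded, so \<^const>\<open>onorm\<close> is their
  genuine operator norm.
\<close>

definition states :: "('a::cstar_algebra \<Rightarrow> complex) set" where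
  "states = {\<phi>. positive_functional \<phi> \<and> onorm \<phi> = 1}"

text \<open>
  The library locale \<^locale>\<open>Metric_space\<close> asks for symmetry and nonnegativity of the distance
  function on the whole type. For a metric given only on a set \<open>M\<close> it is therefore applied
  to the extension by \<open>0\<close>; neither the metric axioms on \<open>M\<close> nor the induced topology depend
  on the values outside \<open>M\<close>.
\<close>

definition dist_on :: "'b set \<Rightarrow> ('b \<Rightarrow> 'b \<Rightarrow> real) \<Rightarrow> 'b \<Rightarrow> 'b \<Rightarrow> real" where
  "dist_on M d = (\<lambda>x y. if x \<in> M \<and> y \<in> M then d x y else 0)"

definition is_metric_on :: "'b set \<Rightarrow> ('b \<Rightarrow> 'b \<Rightarrow> real) \<Rightarrow> bool" where
  "is_metric_on M d \<longleftrightarrow> Metric_space M (dist_on M d)"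

definition metric_topology_on :: "'b set \<Rightarrow> ('b \<Rightarrow> 'b \<Rightarrow> real) \<Rightarrow> 'b topology" where
  "metric_topology_on M d = Metric_space.mtopology M (dist_on M d)"

definition topologically_equivalent ::
  "'b set \<Rightarrow> ('b \<Rightarrow> 'b \<Rightarrow> real) \<Rightarrow> ('b \<Rightarrow> 'b \<Rightarrow> real) \<Rightarrow> bool" where
  "topologically_equivalent M d d' \<longleftrightarrow>
     is_metric_on M d \<and> is_metric_on M d' \<and> metric_topology_on M d = metric_topology_on M d'"

definition mk_dist ::
  "('a::cstar_algebra \<Rightarrow> ennreal) \<Rightarrow> ('a \<Rightarrow> complex) \<Rightarrow> ('a \<Rightarrow> complex) \<Rightarrow> ennreal" where
  "mk_dist L \<phi> \<psi> = (SUP a\<in>{a. L a \<le> 1}. ennreal (cmod (\<phi> a - \<psi> a)))"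

text \<open>
  On functions, \<open>top_of_set states\<close> is the topology of pointwise convergence on the algebra,
  i.e.\ the weak* topology. In the homogeneity clause, \<open>0 * \<infinity> = 0\<close> in \<^typ>\<open>ennreal\<close>, in
  accordance with \<open>L 0 = 0\<close>.
\<close>

definition compact_quantum_metric_space :: "('a::cstar_algebra \<Rightarrow> ennreal) \<Rightarrow> bool" where
  "compact_quantum_metric_space L \<longleftrightarrow>
     (\<forall>a b. L (a + b) \<le> L a + L b) \<and>
     (\<forall>c a. L (c *\<^sub>C a) = ennreal (cmod c) * L a) \<and>
     closure {a. L a < \<infinity>} = UNIV \<and>
     (\<forall>a. L a = 0 \<longleftrightarrow> a \<in> range (\<lambda>c. c *\<^sub>C 1)) \<and>
     (\<forall>a. L a = L (star a)) \<and>
     (\<forall>\<phi>\<in>states. \<forall>\<psi>\<in>states. mk_dist L \<phi> \<psi> < \<infinity>) \<and>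
     is_metric_on states (\<lambda>\<phi> \<psi>. enn2real (mk_dist L \<phi> \<psi>)) \<and>
     metric_topology_on states (\<lambda>\<phi> \<psi>. enn2real (mk_dist L \<phi> \<psi>)) = top_of_set states"

definition faithful_trace :: "('a::cstar_algebra \<Rightarrow> complex) \<Rightarrow> bool" where
  "faithful_trace \<tau> \<longleftrightarrow>
     positive_functional \<tau> \<and> (\<forall>a b. \<tau> (a * b) = \<tau> (b * a)) \<and>
     (\<forall>a. \<tau> (star a * a) = 0 \<longrightarrow> a = 0)"

definition density_space :: "('a::cstar_algebra \<Rightarrow> complex) \<Rightarrow> 'a set" where
  "density_space \<tau> = {a. positive a \<and> \<tau> a = 1}"

definition density_state :: "('a::cstar_algebra \<Rightarrow> complex) \<Rightarrow> 'a \<Rightarrow> 'a \<Rightarrow> complex" where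
  "density_state \<tau> a = (\<lambda>b. \<tau> (a * b))"

definition quantum_metric ::
  "('a::cstar_algebra \<Rightarrow> ennreal) \<Rightarrow> ('a \<Rightarrow> complex) \<Rightarrow> 'a \<Rightarrow> 'a \<Rightarrow> real" where
  "quantum_metric L \<tau> x y = enn2real (mk_dist L (density_state \<tau> x) (density_state \<tau> y))"

text \<open>\<open>Re\<close> is only a type conversion: \<open>\<tau>\<close> is real on the positive element \<open>|\<surd>x \<surd>y|\<close>.\<close>

definition bures_metric :: "('a::cstar_algebra \<Rightarrow> complex) \<Rightarrow> 'a \<Rightarrow> 'a \<Rightarrow> real" where
  "bures_metric \<tau> x y = sqrt (1 - Re (\<tau> (cstar_abs (cstar_sqrt x * cstar_sqrt y))))"

end

theory Submission
  imports Defs "HOL-Computational_Algebra.Fundamental_Theorem_Algebra"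
begin

text \<open>
  Both metrics induce on the density space the topology of pointwise convergence of the functionals
  \<open>w \<mapsto> \<tau> (x * w)\<close>. For the quantum metric this is almost the definition of a compact quantum
  metric space: the Monge--Kantorovich metric induces the weak* topology on the states, and
  \<open>x \<mapsto> \<tau> (x * _)\<close> embeds the densities in the states, injectively because \<open>\<tau>\<close> is faithful.

  For the Bures metric \<open>d\<close>, let \<open>norm2\<close> be the Hilbert--Schmidt norm of \<open>\<tau>\<close> and let \<open>a = \<surd>x\<close>,
  \<open>b = \<surd>y\<close>. The trace norm of \<open>c\<close> is the maximum of \<open>Re (\<tau> (star k * c))\<close> over contractions \<open>k\<close>,
  attained at the partial isometry of the polar decomposition. Hence \<open>2 d(x, y)\<^sup>2\<close> is the
  least squared distance between \<open>b\<close> and \<open>a * k\<close>, after right multiplication by \<open>k\<close> has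
  been dilated to an isometry (\<open>bures_metric_coupling\<close>). Composing optimal \<open>k\<close> gives the triangle inequality
  (\<open>bures_metric_triangle\<close>). A small Bures distance makes \<open>x = a\<^sup>2\<close> and \<open>y = b\<^sup>2\<close> weakly close by
  the Cauchy--Schwarz inequality (\<open>tau_diff_le_bures_metric\<close>), which also shows that distance zero
  implies equality. Conversely \<open>k = 1\<close> bounds the Bures distance by \<open>norm2 (a - b)\<close>, and this
  is controlled by \<open>norm2 (x - y)\<close> through the Powers--Stormer inequality
  (\<open>norm2_diff_le_squares\<close>); in finite dimension weak convergence implies convergence in \<open>norm2\<close> by
  Parseval's identity for a finite orthonormal basis.

  Square roots, absolute values and signs come from a spectral theorem for self-adjoint elements
  of a finite-dimensional C*-algebra, proved inside the algebra: the unit is a sum of eigenvectors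
  of left multiplication, and these are the spectral projections. The positivity of
  \<open>\<tau> (star c * c)\<close>, on which all inequalities rest, follows from the trace property.
\<close>

section \<open>The involution and complex scalars\<close>

interpretation scaleC: vector_space "scaleC :: complex \<Rightarrow> 'a::cstar_algebra \<Rightarrow> 'a"
  by (rule vector_space_scaleC)

lemma additive_star: "Modules.additive (star :: 'a::cstar_algebra \<Rightarrow> 'a)"
  by unfold_locales (rule star_add)

lemmas star_zero [simp] = Modules.additive.zero [OF additive_star]
lemmas star_diff = Modules.additive.diff [OF additive_star]
lemmas star_sum = Modules.additive.sum [OF additive_star]

declare star_star [simp]

lemma star_one [simp]: "star (1 :: 'a::cstar_algebra) = 1"
  using star_mult[of "star 1" "1 :: 'a"] by simp

lemma star_scaleR [simp]: "star (r *\<^sub>R x) = r *\<^sub>R star (x :: 'a::cstar_algebra)"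
  using star_scaleC[of "of_real r" x] by (simp add: scaleC_of_real)

lemma scaleC_scaleR: "c *\<^sub>C (r *\<^sub>R x) = (c * of_real r) *\<^sub>C (x :: 'a::cstar_algebra)"
  by (simp flip: scaleC_of_real add: scaleC_scaleC)

lemma scaleR_scaleC: "r *\<^sub>R (c *\<^sub>C x) = (of_real r * c) *\<^sub>C (x :: 'a::cstar_algebra)"
  by (simp flip: scaleC_of_real add: scaleC_scaleC)

lemma star_mult_self_eq_0_iff [simp]: "star x * x = 0 \<longleftrightarrow> x = (0 :: 'a::cstar_algebra)"
  using cstar_identity[of x] by auto

lemma norm_star [simp]: "norm (star x) = norm (x :: 'a::cstar_algebra)"
proof -
  have le: "norm y \<le> norm (star y)" for y :: 'a
  proof (cases "y = 0")
    case False
    have "norm y * norm y \<le> norm (star y) * norm y"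
      using cstar_identity[of y] norm_mult_ineq[of "star y" y] by (simp add: power2_eq_square)
    with False show ?thesis by simp
  qed simp
  show ?thesis using le[of x] le[of "star x"] by simp
qed

section \<open>The spectral theorem in finite dimension\<close>

text \<open>The coefficients are complex while the argument lies in a noncommutative algebra, so Horner's
  scheme is spelled out with scalar multiples of the unit.\<close>

definition eval_poly :: "complex poly \<Rightarrow> 'a::cstar_algebra \<Rightarrow> 'a" where
  "eval_poly p a = fold_coeffs (\<lambda>c x. c *\<^sub>C 1 + a * x) p 0"

lemma eval_poly_0 [simp]: "eval_poly 0 a = 0"
  by (simp add: eval_poly_def)

lemma eval_poly_pCons [simp]: "eval_poly (pCons c p) a = c *\<^sub>C 1 + a * eval_poly p a"
  by (cases "p = 0 \<and> c = 0") (auto simp: eval_poly_def)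

lemma eval_poly_add: "eval_poly (p + q) a = eval_poly p a + eval_poly q a"
  by (induction p q rule: poly_induct2) (simp_all add: scaleC_add_left algebra_simps)

lemma eval_poly_smult: "eval_poly (smult c p) a = c *\<^sub>C eval_poly p a"
  by (induction p) (simp_all add: scaleC_add_right scaleC_scaleC mult_scaleC_right)

lemma eval_poly_monom: "eval_poly (monom c n) a = c *\<^sub>C a ^ n"
  by (induction n) (simp_all add: monom_Suc monom_0 mult_scaleC_right)

lemma eval_poly_sum: "eval_poly (sum f A) a = (\<Sum>i\<in>A. eval_poly (f i) a)"
  by (induction A rule: infinite_finite_induct) (simp_all add: eval_poly_add)

text \<open>More powers of \<open>a\<close> than the dimension of the algebra cannot be linearly independent.\<close>

lemma exists_annihilating_poly:
  fixes a :: "'a::cstar_algebra"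
  assumes "\<exists>B. finite_dimensional_vector_space (scaleC :: complex \<Rightarrow> 'a \<Rightarrow> 'a) B"
  shows "\<exists>p. p \<noteq> 0 \<and> eval_poly p a = 0"
proof -
  from assms obtain B where
    "finite_dimensional_vector_space (scaleC :: complex \<Rightarrow> 'a \<Rightarrow> 'a) B" ..
  then interpret B: finite_dimensional_vector_space "scaleC :: complex \<Rightarrow> 'a \<Rightarrow> 'a" B .
  define f where "f i = a ^ i" for i :: nat
  show ?thesis
  proof (cases "inj_on f {..card B}")
    case True
    have "scaleC.dependent (f ` {..card B})"
    proof (rule ccontr)
      assume "\<not> ?thesis"
      then have "card (f ` {..card B}) \<le> card B"
        using scaleC.independent_span_bound[of B "f ` {..card B}"] B.finite_Basis B.span_Basis by simp
      then show False by (simp add: card_image True)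
    qed
    then obtain u where u: "\<exists>v\<in>f ` {..card B}. u v \<noteq> 0"
        "(\<Sum>v\<in>f ` {..card B}. u v *\<^sub>C v) = 0"
      by (subst (asm) scaleC.dependent_finite) auto
    then obtain k where k: "k \<le> card B" "u (f k) \<noteq> 0" by auto
    define p where "p = (\<Sum>i\<le>card B. monom (u (f i)) i)"
    have "coeff p k = u (f k)"
      using k by (simp add: p_def coeff_sum)
    then have "p \<noteq> 0" using k by auto
    moreover have "(\<Sum>i\<le>card B. u (f i) *\<^sub>C f i) = 0"
      using u(2) sum.reindex[OF True, of "\<lambda>v. u v *\<^sub>C v"] by simp
    then have "eval_poly p a = 0"
      by (simp add: p_def eval_poly_sum eval_poly_monom f_def)
    ultimately show ?thesis by blast
  next
    case False
    then obtain i j where ij: "i \<noteq> j" "a ^ i = a ^ j" by (auto simp: inj_on_def f_def)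
    define p :: "complex poly" where "p = monom 1 i + monom (- 1) j"
    have "coeff p i = 1" using ij by (simp add: p_def)
    then have "p \<noteq> 0" by auto
    moreover have "eval_poly p a = 0"
      using ij by (simp add: p_def eval_poly_add eval_poly_monom)
    ultimately show ?thesis by blast
  qed
qed

text \<open>The algebra is regarded as a left module over itself, so that eigenvectors of \<open>a\<close> are
  elements of the algebra and no representation on a Hilbert space is involved.\<close>

definition eigen_sum :: "'a::cstar_algebra \<Rightarrow> 'a \<Rightarrow> bool" where
  "eigen_sum a w \<longleftrightarrow> (\<exists>S v. finite S \<and> (\<forall>\<alpha>\<in>S. a * v \<alpha> = \<alpha> *\<^sub>R v \<alpha>) \<and> w = (\<Sum>\<alpha>\<in>S. v \<alpha>))"

lemma eigen_sum_0: "eigen_sum a 0"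
  unfolding eigen_sum_def by (intro exI[of _ "{}"]) simp

lemma eigen_sum_add_eigenvector:
  assumes "eigen_sum a w" "a * x = \<mu> *\<^sub>R x"
  shows "eigen_sum a (w + x)"
proof -
  from assms obtain S v where v: "finite S" "\<forall>\<alpha>\<in>S. a * v \<alpha> = \<alpha> *\<^sub>R v \<alpha>" "w = (\<Sum>\<alpha>\<in>S. v \<alpha>)"
    unfolding eigen_sum_def by blast
  define u where "u \<alpha> = (if \<alpha> \<in> S then v \<alpha> else 0) + (if \<alpha> = \<mu> then x else 0)" for \<alpha>
  have "(\<Sum>\<alpha>\<in>insert \<mu> S. u \<alpha>) = (\<Sum>\<alpha>\<in>insert \<mu> S. if \<alpha> \<in> S then v \<alpha> else 0)
      + (\<Sum>\<alpha>\<in>insert \<mu> S. if \<alpha> = \<mu> then x else 0)"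
    unfolding u_def by (rule sum.distrib)
  also have "\<dots> = (\<Sum>\<alpha>\<in>S. v \<alpha>) + x"
    using v(1) by (intro arg_cong2[of _ _ _ _ "(+)"] sum.mono_neutral_cong_right) auto
  finally have "w + x = (\<Sum>\<alpha>\<in>insert \<mu> S. u \<alpha>)" using v(3) by simp
  moreover have "\<forall>\<alpha>\<in>insert \<mu> S. a * u \<alpha> = \<alpha> *\<^sub>R u \<alpha>"
    using v(2) assms(2) by (auto simp: u_def algebra_simps)
  ultimately show ?thesis using v(1) unfolding eigen_sum_def by blast
qed

lemma eigen_sum_scaleC:
  assumes "eigen_sum a w"
  shows "eigen_sum a (c *\<^sub>C w)"
proof -
  from assms obtain S v where v: "finite S" "\<forall>\<alpha>\<in>S. a * v \<alpha> = \<alpha> *\<^sub>R v \<alpha>" "w = (\<Sum>\<alpha>\<in>S. v \<alpha>)"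
    unfolding eigen_sum_def by blast
  then show ?thesis unfolding eigen_sum_def
    by (intro exI[of _ S] exI[of _ "\<lambda>\<alpha>. c *\<^sub>C v \<alpha>"])
      (auto simp: scaleC.scale_sum_right mult_scaleC_right scaleR_scaleC scaleC_scaleR mult.commute)
qed

lemma selfadjoint_nonreal_eigenvalue:
  fixes a w :: "'a::cstar_algebra"
  assumes "star a = a" "a * w = z *\<^sub>C w" "Im z \<noteq> 0"
  shows "w = 0"
proof -
  have "z *\<^sub>C (star w * w) = star w * (a * w)"
    by (simp add: assms(2) mult_scaleC_right)
  also have "\<dots> = star (a * w) * w"
    by (simp add: star_mult assms(1) mult.assoc)
  also have "\<dots> = cnj z *\<^sub>C (star w * w)"
    by (simp add: assms(2) star_scaleC mult_scaleC_left)
  finally have "(z - cnj z) *\<^sub>C (star w * w) = 0"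
    by (simp add: scaleC.scale_left_diff_distrib)
  moreover have "z - cnj z \<noteq> 0"
    using assms(3) by (simp add: complex_eq_iff)
  ultimately show ?thesis by simp
qed

text \<open>\<open>star y * y = star w * (a - \<mu>) * y\<close>, because \<open>a - \<mu>\<close> is self-adjoint.\<close>

lemma selfadjoint_generalised_eigenvector:
  fixes a w :: "'a::cstar_algebra"
  assumes "star a = a" and y: "y = a * w - \<mu> *\<^sub>R w" "a * y = \<mu> *\<^sub>R y"
  shows "y = 0"
proof -
  have "star y * y = star w * (a * y - \<mu> *\<^sub>R y)"
    by (subst (1) y(1)) (simp add: star_diff star_mult assms(1) algebra_simps)
  then show ?thesis using y(2) by simp
qed

text \<open>Dividing out one linear factor: the components with eigenvalue \<open>\<alpha> \<noteq> z\<close> are divided by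
  \<open>\<alpha> - z\<close>. What remains is a generalised eigenvector for \<open>z\<close>, hence zero or a genuine
  eigenvector for a real eigenvalue, because \<open>a\<close> is self-adjoint.\<close>

lemma eigen_sum_divide:
  fixes a w :: "'a::cstar_algebra"
  assumes a: "star a = a" and w: "eigen_sum a (a * w - z *\<^sub>C w)"
  shows "eigen_sum a w"
proof -
  from w obtain S v where v: "finite S" "\<forall>\<alpha>\<in>S. a * v \<alpha> = \<alpha> *\<^sub>R v \<alpha>"
      "a * w - z *\<^sub>C w = (\<Sum>\<alpha>\<in>S. v \<alpha>)"
    unfolding eigen_sum_def by blast
  \<comment> \<open>If \<open>\<alpha> = z\<close> the inverse is \<open>0\<close>, so that \<open>u z = 0\<close>.\<close>
  define u where "u \<alpha> = inverse (of_real \<alpha> - z) *\<^sub>C v \<alpha>" for \<alpha>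
  have au: "a * u \<alpha> = \<alpha> *\<^sub>R u \<alpha>" if "\<alpha> \<in> S" for \<alpha>
    using v(2) that by (simp add: u_def mult_scaleC_right scaleC_scaleR scaleR_scaleC mult.commute)
  define x where "x = w - (\<Sum>\<alpha>\<in>S. u \<alpha>)"
  define y where "y = a * x - z *\<^sub>C x"
  have "y = (\<Sum>\<alpha>\<in>S. v \<alpha>) - (\<Sum>\<alpha>\<in>S. a * u \<alpha> - z *\<^sub>C u \<alpha>)"
    by (simp add: y_def x_def algebra_simps scaleC.scale_right_diff_distrib sum_distrib_left
        scaleC.scale_sum_right sum_subtractf flip: v(3))
  also have "\<dots> = (\<Sum>\<alpha>\<in>S. v \<alpha> - (of_real \<alpha> - z) *\<^sub>C u \<alpha>)"
    by (simp add: sum_subtractf au scaleC.scale_left_diff_distrib scaleC_of_real)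
  also have "\<dots> = (\<Sum>\<alpha>\<in>S. if of_real \<alpha> = z then v \<alpha> else 0)"
    by (intro sum.cong) (auto simp: u_def scaleC_scaleC)
  finally have y: "y = (\<Sum>\<alpha>\<in>S. if of_real \<alpha> = z then v \<alpha> else 0)" .
  have sum_u: "eigen_sum a (\<Sum>\<alpha>\<in>S. u \<alpha>)"
    using v(1) au unfolding eigen_sum_def by blast
  have w_eq: "w = (\<Sum>\<alpha>\<in>S. u \<alpha>) + x" by (simp add: x_def)
  show ?thesis
  proof (cases "Im z = 0")
    case True
    define \<mu> where "\<mu> = Re z"
    have z: "z = of_real \<mu>" using True by (simp add: \<mu>_def complex_eq_iff)
    have "a * y = \<mu> *\<^sub>R y"
      using v(2) by (auto simp: y z sum_distrib_left scaleR_sum_right intro!: sum.cong)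
    then have "y = 0"
      using selfadjoint_generalised_eigenvector[OF a, of y x \<mu>] by (simp add: y_def z scaleC_of_real)
    then have "a * x = \<mu> *\<^sub>R x" by (simp add: y_def z scaleC_of_real)
    then show ?thesis using eigen_sum_add_eigenvector[OF sum_u] w_eq by metis
  next
    case False
    then have "y = 0" using y by (auto intro!: sum.neutral)
    then have "x = 0"
      using selfadjoint_nonreal_eigenvalue[OF a _ False] by (simp add: y_def)
    then show ?thesis using sum_u w_eq by simp
  qed
qed

text \<open>The linear factors of the polynomial are divided out one at a time; they exist by the
  fundamental theorem of algebra.\<close>

lemma eigen_sum_eval_poly:
  fixes a w :: "'a::cstar_algebra"
  assumes a: "star a = a"
  shows "p \<noteq> 0 \<Longrightarrow> eigen_sum a (eval_poly p a * w) \<Longrightarrow> eigen_sum a w"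
proof (induction "degree p" arbitrary: p)
  case 0
  then obtain c where c: "p = [:c:]" by (metis degree_0_id)
  with 0 have "c \<noteq> 0" "eigen_sum a (c *\<^sub>C w)"
    by (auto simp: mult_scaleC_left)
  then show ?case
    using eigen_sum_scaleC[of a "c *\<^sub>C w" "inverse c"] by (simp add: scaleC_scaleC)
next
  case (Suc n)
  then have "\<not> constant (poly p)" by (simp add: constant_degree)
  then obtain z where "poly p z = 0" using fundamental_theorem_of_algebra by blast
  then obtain q where q: "p = [:- z, 1:] * q" by (meson dvdE poly_eq_0_iff_dvd)
  with Suc have "q \<noteq> 0" by auto
  then have "degree p = Suc (degree q)"
    unfolding q using degree_mult_eq[of "[:- z, 1:]" q] by (simp del: mult_pCons_left)
  with Suc have "n = degree q" by simp
  have "p = pCons 0 q + smult (- z) q" by (simp add: q)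
  then have "eval_poly p a = a * eval_poly q a - z *\<^sub>C eval_poly q a"
    by (simp only: eval_poly_add eval_poly_smult eval_poly_pCons) simp
  then have "eval_poly p a * w = a * (eval_poly q a * w) - z *\<^sub>C (eval_poly q a * w)"
    by (simp add: left_diff_distrib mult_scaleC_left mult.assoc)
  with Suc.prems have "eigen_sum a (eval_poly q a * w)"
    using eigen_sum_divide[OF a] by metis
  with Suc.hyps(1) \<open>n = degree q\<close> \<open>q \<noteq> 0\<close> show ?case by blast
qed

locale spectral_resolution =
  fixes S :: "real set" and e :: "real \<Rightarrow> 'a::cstar_algebra"
  assumes finite: "finite S"
    and nonzero: "\<alpha> \<in> S \<Longrightarrow> e \<alpha> \<noteq> 0"
    and selfadjoint: "\<alpha> \<in> S \<Longrightarrow> star (e \<alpha>) = e \<alpha>"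
    and orthogonal: "\<alpha> \<in> S \<Longrightarrow> \<mu> \<in> S \<Longrightarrow> e \<alpha> * e \<mu> = (if \<alpha> = \<mu> then e \<alpha> else 0)"
    and complete: "(\<Sum>\<alpha>\<in>S. e \<alpha>) = 1"

text \<open>The functional calculus: if \<open>e\<close> consists of the spectral projections of \<open>a\<close>, this is \<open>f(a)\<close>,
  and the identity function gives \<open>a\<close> itself.\<close>

definition calc :: "real set \<Rightarrow> (real \<Rightarrow> 'a) \<Rightarrow> (real \<Rightarrow> real) \<Rightarrow> 'a::cstar_algebra" where
  "calc S e f = (\<Sum>\<alpha>\<in>S. f \<alpha> *\<^sub>R e \<alpha>)"

text \<open>The unit is annihilated by a polynomial in \<open>a\<close>, so it is a sum of eigenvectors \<open>e \<alpha>\<close>.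
  Eigenvectors for distinct eigenvalues satisfy \<open>star (e \<alpha>) * e \<mu> = 0\<close>, and multiplying
  \<open>1 = \<Sum>\<alpha>. star (e \<alpha>)\<close> by \<open>e \<mu>\<close> then shows that each \<open>e \<mu>\<close> is a self-adjoint projection.\<close>

theorem spectral_theorem:
  fixes a :: "'a::cstar_algebra"
  assumes fd: "\<exists>B. finite_dimensional_vector_space (scaleC :: complex \<Rightarrow> 'a \<Rightarrow> 'a) B"
    and a: "star a = a"
  obtains S e where "spectral_resolution S e" "a = calc S e (\<lambda>\<alpha>. \<alpha>)"
proof -
  obtain p where "p \<noteq> 0" "eval_poly p a = 0" using exists_annihilating_poly[OF fd] by blast
  then have "eigen_sum a 1" using eigen_sum_eval_poly[OF a, of p 1] by (simp add: eigen_sum_0)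
  then obtain S0 e where e0: "finite S0" "\<forall>\<alpha>\<in>S0. a * e \<alpha> = \<alpha> *\<^sub>R e \<alpha>" "1 = (\<Sum>\<alpha>\<in>S0. e \<alpha>)"
    unfolding eigen_sum_def by blast
  define S where "S = {\<alpha>\<in>S0. e \<alpha> \<noteq> 0}"
  have fin: "finite S" using e0 by (simp add: S_def)
  have eig: "a * e \<alpha> = \<alpha> *\<^sub>R e \<alpha>" if "\<alpha> \<in> S" for \<alpha> using e0(2) that by (simp add: S_def)
  have one: "(\<Sum>\<alpha>\<in>S. e \<alpha>) = 1"
    unfolding e0(3) by (rule sum.mono_neutral_left) (use e0(1) in \<open>auto simp: S_def\<close>)
  have orth: "star (e \<alpha>) * e \<mu> = 0" if "\<alpha> \<in> S" "\<mu> \<in> S" "\<alpha> \<noteq> \<mu>" for \<alpha> \<mu>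
  proof -
    have "\<alpha> *\<^sub>R (star (e \<alpha>) * e \<mu>) = star (a * e \<alpha>) * e \<mu>" using that by (simp add: eig)
    also have "\<dots> = star (e \<alpha>) * (a * e \<mu>)" by (simp add: star_mult a mult.assoc)
    also have "\<dots> = \<mu> *\<^sub>R (star (e \<alpha>) * e \<mu>)" using that by (simp add: eig)
    finally show ?thesis using that(3) by simp
  qed
  have proj: "e \<mu> = star (e \<mu>) * e \<mu>" if "\<mu> \<in> S" for \<mu>
  proof -
    have "e \<mu> = star (\<Sum>\<alpha>\<in>S. e \<alpha>) * e \<mu>" by (simp add: one)
    also have "\<dots> = (\<Sum>\<alpha>\<in>S. star (e \<alpha>) * e \<mu>)" by (simp add: star_sum sum_distrib_right)
    also have "\<dots> = (\<Sum>\<alpha>\<in>S. if \<alpha> = \<mu> then star (e \<mu>) * e \<mu> else 0)"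
      using orth that by (intro sum.cong) auto
    finally show ?thesis using that fin by simp
  qed
  have sa: "star (e \<alpha>) = e \<alpha>" if "\<alpha> \<in> S" for \<alpha>
    by (metis proj[OF that] star_mult star_star)
  have "spectral_resolution S e"
  proof
    show "e \<alpha> * e \<mu> = (if \<alpha> = \<mu> then e \<alpha> else 0)" if "\<alpha> \<in> S" "\<mu> \<in> S" for \<alpha> \<mu>
      using orth[OF that] proj[OF that(1)] sa[OF that(1)] by auto
  qed (use fin sa one in \<open>auto simp: S_def\<close>)
  moreover have "a = a * (\<Sum>\<alpha>\<in>S. e \<alpha>)" by (simp add: one)
  then have "a = calc S e (\<lambda>\<alpha>. \<alpha>)" by (simp add: calc_def sum_distrib_left eig)
  ultimately show thesis by (rule that)
qed

context spectral_resolution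
begin

lemma calc_cong: "(\<And>\<alpha>. \<alpha> \<in> S \<Longrightarrow> f \<alpha> = g \<alpha>) \<Longrightarrow> calc S e f = calc S e g"
  by (simp add: calc_def)

lemma calc_one: "calc S e (\<lambda>\<alpha>. 1) = 1"
  by (simp add: calc_def complete)

lemma calc_add: "calc S e (\<lambda>\<alpha>. f \<alpha> + g \<alpha>) = calc S e f + calc S e g"
  by (simp add: calc_def scaleR_add_left sum.distrib)

lemma calc_diff: "calc S e (\<lambda>\<alpha>. f \<alpha> - g \<alpha>) = calc S e f - calc S e g"
  by (simp add: calc_def scaleR_diff_left sum_subtractf)

lemma calc_mult_projection: "\<mu> \<in> S \<Longrightarrow> calc S e f * e \<mu> = f \<mu> *\<^sub>R e \<mu>"
  using finite by (simp add: calc_def sum_distrib_right orthogonal if_distrib cong: if_cong)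

lemma projection_mult_calc: "\<mu> \<in> S \<Longrightarrow> e \<mu> * calc S e f = f \<mu> *\<^sub>R e \<mu>"
  using finite by (simp add: calc_def sum_distrib_left orthogonal if_distrib cong: if_cong)

lemma calc_mult: "calc S e f * calc S e g = calc S e (\<lambda>\<alpha>. f \<alpha> * g \<alpha>)"
proof -
  have "calc S e f * calc S e g = (\<Sum>\<mu>\<in>S. g \<mu> *\<^sub>R (calc S e f * e \<mu>))"
    by (simp add: calc_def[of _ _ g] sum_distrib_left)
  also have "\<dots> = calc S e (\<lambda>\<alpha>. f \<alpha> * g \<alpha>)"
    by (simp add: calc_mult_projection calc_def[of _ _ "\<lambda>\<alpha>. f \<alpha> * g \<alpha>"] mult.commute)
  finally show ?thesis .
qed

lemma star_calc [simp]: "star (calc S e f) = calc S e f"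
  by (simp add: calc_def star_sum selfadjoint)

lemma spectrum_calc: "spectrum (calc S e f) = (\<lambda>\<alpha>. of_real (f \<alpha>)) ` S"
proof (intro equalityI subsetI)
  fix z :: complex assume "z \<in> (\<lambda>\<alpha>. of_real (f \<alpha>)) ` S"
  then obtain \<alpha> where l: "\<alpha> \<in> S" "z = of_real (f \<alpha>)" by blast
  have "b * (calc S e f - z *\<^sub>C 1) \<noteq> 1" for b
  proof
    assume "b * (calc S e f - z *\<^sub>C 1) = 1"
    moreover have "(calc S e f - z *\<^sub>C 1) * e \<alpha> = 0"
      using l by (simp add: left_diff_distrib calc_mult_projection scaleC_of_real)
    ultimately have "e \<alpha> = 0"
      by (metis mult.assoc mult_1 mult_zero_right)
    with nonzero l show False by blast
  qed
  then show "z \<in> spectrum (calc S e f)" by (simp add: spectrum_def)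
next
  fix z :: complex assume z: "z \<in> spectrum (calc S e f)"
  show "z \<in> (\<lambda>\<alpha>. of_real (f \<alpha>)) ` S"
  proof (rule ccontr)
    assume out: "z \<notin> (\<lambda>\<alpha>. of_real (f \<alpha>)) ` S"
    define b where "b = (\<Sum>\<alpha>\<in>S. inverse (of_real (f \<alpha>) - z) *\<^sub>C e \<alpha>)"
    have left: "(calc S e f - z *\<^sub>C 1) * e \<alpha> = (of_real (f \<alpha>) - z) *\<^sub>C e \<alpha>" if "\<alpha> \<in> S" for \<alpha>
      using that by (simp add: left_diff_distrib calc_mult_projection mult_scaleC_left
          scaleC.scale_left_diff_distrib scaleC_of_real)
    have right: "e \<alpha> * (calc S e f - z *\<^sub>C 1) = (of_real (f \<alpha>) - z) *\<^sub>C e \<alpha>" if "\<alpha> \<in> S" for \<alpha>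
      using that by (simp add: right_diff_distrib projection_mult_calc mult_scaleC_right
          scaleC.scale_left_diff_distrib scaleC_of_real)
    have nz: "of_real (f \<alpha>) - z \<noteq> 0" if "\<alpha> \<in> S" for \<alpha> using out that by auto
    have "(calc S e f - z *\<^sub>C 1) * b = (\<Sum>\<alpha>\<in>S. e \<alpha>)" unfolding b_def sum_distrib_left
      by (intro sum.cong) (use nz in \<open>auto simp: mult_scaleC_right left scaleC_scaleC\<close>)
    moreover have "b * (calc S e f - z *\<^sub>C 1) = (\<Sum>\<alpha>\<in>S. e \<alpha>)" unfolding b_def sum_distrib_right
      by (intro sum.cong) (use nz in \<open>auto simp: mult_scaleC_left right scaleC_scaleC\<close>)
    ultimately show False using z by (auto simp: spectrum_def complete)
  qed
qed

lemma positive_calc_iff: "positive (calc S e f) \<longleftrightarrow> (\<forall>\<alpha>\<in>S. 0 \<le> f \<alpha>)"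
  by (auto simp: positive_def spectrum_calc complex_nonneg_Reals_iff)

text \<open>An element of the spectrum is an eigenvalue, so it is bounded by the norm.\<close>

lemma abs_calc_le_norm:
  assumes "\<alpha> \<in> S"
  shows "\<bar>f \<alpha>\<bar> \<le> norm (calc S e f)"
proof -
  have "\<bar>f \<alpha>\<bar> * norm (e \<alpha>) = norm (calc S e f * e \<alpha>)"
    using assms by (simp add: calc_mult_projection)
  also have "\<dots> \<le> norm (calc S e f) * norm (e \<alpha>)" by (rule norm_mult_ineq)
  finally show ?thesis using nonzero[OF assms] by simp
qed

end

section \<open>Positive square roots\<close>

lemma positive_cases:
  fixes a :: "'a::cstar_algebra"
  assumes "\<exists>B. finite_dimensional_vector_space (scaleC :: complex \<Rightarrow> 'a \<Rightarrow> 'a) B" "positive a"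
  obtains S e where "spectral_resolution S e" "a = calc S e (\<lambda>\<alpha>. \<alpha>)" "\<And>\<alpha>. \<alpha> \<in> S \<Longrightarrow> 0 \<le> \<alpha>"
proof -
  have "star a = a" using assms(2) by (simp add: positive_def)
  from spectral_theorem[OF assms(1) this] obtain S e
    where "spectral_resolution S e" "a = calc S e (\<lambda>\<alpha>. \<alpha>)" .
  with assms(2) show thesis
    by (intro that[of S e]) (auto simp: spectral_resolution.positive_calc_iff)
qed

text \<open>If the squares agree, spectral projections of the two elements for distinct eigenvalues
  annihilate each other, since \<open>\<alpha>\<^sup>2 = \<beta>\<^sup>2\<close> forces \<open>\<alpha> = \<beta>\<close> for nonnegative numbers; refining both
  resolutions of the unit by each other then identifies the elements.\<close>

lemma positive_square_inject:
  fixes b c :: "'a::cstar_algebra"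
  assumes fd: "\<exists>B. finite_dimensional_vector_space (scaleC :: complex \<Rightarrow> 'a \<Rightarrow> 'a) B"
    and "positive b" "positive c" and eq: "b * b = c * c"
  shows "b = c"
proof -
  obtain S e where S: "spectral_resolution S e" "b = calc S e (\<lambda>\<alpha>. \<alpha>)" "\<And>\<alpha>. \<alpha> \<in> S \<Longrightarrow> 0 \<le> \<alpha>"
    using positive_cases[OF fd \<open>positive b\<close>] by blast
  obtain T f where T: "spectral_resolution T f" "c = calc T f (\<lambda>\<alpha>. \<alpha>)" "\<And>\<beta>. \<beta> \<in> T \<Longrightarrow> 0 \<le> \<beta>"
    using positive_cases[OF fd \<open>positive c\<close>] by blast
  interpret S: spectral_resolution S e by fact
  interpret T: spectral_resolution T f by fact
  have swap: "\<alpha> *\<^sub>R (e \<alpha> * f \<beta>) = \<beta> *\<^sub>R (e \<alpha> * f \<beta>)" if "\<alpha> \<in> S" "\<beta> \<in> T" for \<alpha> \<beta>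
  proof -
    have "(\<alpha> * \<alpha>) *\<^sub>R (e \<alpha> * f \<beta>) = e \<alpha> * (b * b) * f \<beta>"
      using that by (simp add: S(2) S.calc_mult S.projection_mult_calc)
    also have "\<dots> = e \<alpha> * ((c * c) * f \<beta>)" by (simp add: eq mult.assoc)
    also have "\<dots> = (\<beta> * \<beta>) *\<^sub>R (e \<alpha> * f \<beta>)"
      using that by (simp add: T(2) T.calc_mult T.calc_mult_projection)
    finally have "e \<alpha> * f \<beta> = 0 \<or> \<alpha> * \<alpha> = \<beta> * \<beta>"
      unfolding scaleR_cancel_right by blast
    then show ?thesis
      using S(3)[OF that(1)] T(3)[OF that(2)] by (auto simp: square_eq_iff)
  qed
  have "b = (\<Sum>\<alpha>\<in>S. \<alpha> *\<^sub>R e \<alpha>) * (\<Sum>\<beta>\<in>T. f \<beta>)" by (simp add: S(2) T.complete calc_def)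
  also have "\<dots> = (\<Sum>\<alpha>\<in>S. \<Sum>\<beta>\<in>T. \<alpha> *\<^sub>R (e \<alpha> * f \<beta>))" by (simp add: sum_product)
  also have "\<dots> = (\<Sum>\<alpha>\<in>S. \<Sum>\<beta>\<in>T. \<beta> *\<^sub>R (e \<alpha> * f \<beta>))" by (intro sum.cong refl swap)
  also have "\<dots> = (\<Sum>\<alpha>\<in>S. e \<alpha>) * (\<Sum>\<beta>\<in>T. \<beta> *\<^sub>R f \<beta>)" by (simp add: sum_product)
  also have "\<dots> = c" by (simp add: T(2) S.complete calc_def)
  finally show ?thesis .
qed

lemma cstar_sqrt_eqI:
  fixes b :: "'a::cstar_algebra"
  assumes "\<exists>B. finite_dimensional_vector_space (scaleC :: complex \<Rightarrow> 'a \<Rightarrow> 'a) B"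
    and "positive b" "b * b = a"
  shows "cstar_sqrt a = b"
  unfolding cstar_sqrt_def
  by (rule the_equality) (use assms positive_square_inject[OF assms(1)] in auto)

lemma cstar_sqrt_positive:
  fixes a :: "'a::cstar_algebra"
  assumes fd: "\<exists>B. finite_dimensional_vector_space (scaleC :: complex \<Rightarrow> 'a \<Rightarrow> 'a) B"
    and "positive a"
  shows "positive (cstar_sqrt a)" "cstar_sqrt a * cstar_sqrt a = a"
proof -
  obtain S e where S: "spectral_resolution S e" "a = calc S e (\<lambda>\<alpha>. \<alpha>)" "\<And>\<alpha>. \<alpha> \<in> S \<Longrightarrow> 0 \<le> \<alpha>"
    using positive_cases[OF assms] by blast
  interpret spectral_resolution S e by fact
  define b where "b = calc S e sqrt"
  have "positive b" using S(3) by (simp add: b_def positive_calc_iff)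
  moreover have "b * b = a"
    unfolding b_def S(2) calc_mult by (rule calc_cong) (simp add: S(3))
  ultimately show "positive (cstar_sqrt a)" "cstar_sqrt a * cstar_sqrt a = a"
    using cstar_sqrt_eqI[OF fd] by auto
qed

section \<open>The Hilbert--Schmidt norm of a faithful trace\<close>

locale tracial_algebra =
  fixes \<tau> :: "'a::cstar_algebra \<Rightarrow> complex"
  assumes faithful_trace: "faithful_trace \<tau>"
    and finite_dimensional: "\<exists>B. finite_dimensional_vector_space (scaleC :: complex \<Rightarrow> 'a \<Rightarrow> 'a) B"
begin

lemma linear_tau: "Vector_Spaces.linear scaleC (*) \<tau>"
  using faithful_trace by (simp add: faithful_trace_def positive_functional_def)

interpretation tau: Vector_Spaces.linear scaleC "(*)" \<tau>
  by (rule linear_tau)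

lemma tau_linear [simp]:
  "\<tau> 0 = 0" "\<tau> (a + b) = \<tau> a + \<tau> b" "\<tau> (a - b) = \<tau> a - \<tau> b" "\<tau> (- a) = - \<tau> a"
  "\<tau> (c *\<^sub>C a) = c * \<tau> a" "\<tau> (r *\<^sub>R a) = of_real r * \<tau> a"
  "\<tau> (sum g A) = (\<Sum>i\<in>A. \<tau> (g i))"
  using tau.scale[of "of_real r" a]
  by (simp_all add: tau.zero tau.add tau.diff tau.neg tau.scale tau.sum scaleC_of_real)

lemma tau_commute: "\<tau> (a * b) = \<tau> (b * a)"
  using faithful_trace by (simp add: faithful_trace_def)

lemma tau_positive: "positive a \<Longrightarrow> \<tau> a \<in> \<real>\<^sub>\<ge>\<^sub>0"
  using faithful_trace by (simp add: faithful_trace_def positive_functional_def)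

lemma positive_square:
  fixes h :: 'a
  assumes "star h = h"
  shows "positive (h * h)"
proof -
  obtain S e where "spectral_resolution S e" and h: "h = calc S e (\<lambda>\<alpha>. \<alpha>)"
    using spectral_theorem[OF finite_dimensional assms] .
  then interpret spectral_resolution S e by simp
  show ?thesis by (simp add: h calc_mult positive_calc_iff)
qed

text \<open>A self-adjoint element is a difference of positive ones.\<close>

lemma tau_selfadjoint:
  assumes "star h = h"
  shows "\<tau> h \<in> \<real>"
proof -
  obtain S e where "spectral_resolution S e" and h: "h = calc S e (\<lambda>\<alpha>. \<alpha>)"
    using spectral_theorem[OF finite_dimensional assms] .
  then interpret spectral_resolution S e by simp
  have "h = calc S e (\<lambda>\<alpha>. max \<alpha> 0) - calc S e (\<lambda>\<alpha>. max (- \<alpha>) 0)"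
    unfolding h calc_diff[symmetric] by (rule calc_cong) auto
  moreover have "\<tau> (calc S e (\<lambda>\<alpha>. max \<alpha> 0)) \<in> \<real>\<^sub>\<ge>\<^sub>0" "\<tau> (calc S e (\<lambda>\<alpha>. max (- \<alpha>) 0)) \<in> \<real>\<^sub>\<ge>\<^sub>0"
    by (auto intro!: tau_positive simp: positive_calc_iff)
  ultimately show ?thesis by (auto simp: complex_nonneg_Reals_iff complex_is_Real_iff)
qed

lemma tau_star: "\<tau> (star a) = cnj (\<tau> a)"
proof -
  have "\<tau> (a + star a) \<in> \<real>" "\<tau> (\<i> *\<^sub>C (a - star a)) \<in> \<real>"
    by (intro tau_selfadjoint; simp add: star_add star_diff star_scaleC add.commute
        scaleC.scale_right_diff_distrib)+
  then show ?thesis by (simp add: complex_is_Real_iff complex_eq_iff)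
qed

text \<open>Here the trace property replaces the classical theorem that \<open>star c * c\<close> is positive:
  with \<open>p = c + star c\<close> and \<open>q = \<i> (c - star c)\<close> one has
  \<open>p\<^sup>2 + q\<^sup>2 = 2 (star c * c + c * star c)\<close>, and both summands have the same trace.\<close>

lemma tau_star_mult_self_nonneg: "\<tau> (star c * c) \<in> \<real>\<^sub>\<ge>\<^sub>0"
proof -
  define p where "p = c + star c"
  define q where "q = \<i> *\<^sub>C (c - star c)"
  have "\<tau> (p * p) \<in> \<real>\<^sub>\<ge>\<^sub>0" "\<tau> (q * q) \<in> \<real>\<^sub>\<ge>\<^sub>0"
    by (intro tau_positive positive_square; simp add: p_def q_def star_add star_diff star_scaleC
        add.commute scaleC.scale_right_diff_distrib)+
  moreover have "\<tau> (p * p) + \<tau> (q * q) = 4 * \<tau> (star c * c)"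
    by (simp add: p_def q_def algebra_simps mult_scaleC_left mult_scaleC_right scaleC_scaleC
        tau_commute[of c "star c"])
  ultimately have "4 * \<tau> (star c * c) \<in> \<real>\<^sub>\<ge>\<^sub>0" by (metis nonneg_Reals_add_I)
  then show ?thesis by (simp add: complex_nonneg_Reals_iff)
qed

text \<open>The norm of the GNS Hilbert space of \<open>\<tau>\<close>, into which the algebra embeds by
  faithfulness.\<close>

definition norm2 :: "'a \<Rightarrow> real" where
  "norm2 a = sqrt (Re (\<tau> (star a * a)))"

lemma tau_star_mult_self: "\<tau> (star a * a) = of_real ((norm2 a)\<^sup>2)"
  using tau_star_mult_self_nonneg[of a]
  by (auto simp: norm2_def complex_nonneg_Reals_iff complex_eq_iff simp flip: of_real_power)

lemma norm2_square: "(norm2 a)\<^sup>2 = Re (\<tau> (star a * a))"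
  by (simp add: tau_star_mult_self flip: of_real_power)

lemma norm2_nonneg [simp]: "0 \<le> norm2 a"
  using tau_star_mult_self_nonneg[of a] by (simp add: norm2_def complex_nonneg_Reals_iff)

lemma norm2_eq_0_iff [simp]: "norm2 a = 0 \<longleftrightarrow> a = 0"
proof
  assume "norm2 a = 0"
  then have "\<tau> (star a * a) = 0" by (simp add: tau_star_mult_self)
  then show "a = 0" using faithful_trace by (simp add: faithful_trace_def)
qed (simp add: norm2_def)

lemma norm2_star [simp]: "norm2 (star a) = norm2 a"
  by (simp add: norm2_def tau_commute[of a])

lemma norm2_scaleC: "norm2 (c *\<^sub>C a) = cmod c * norm2 a"
proof -
  have "\<tau> (star (c *\<^sub>C a) * (c *\<^sub>C a)) = of_real ((cmod c)\<^sup>2) * \<tau> (star a * a)"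
    using complex_norm_square[of c]
    by (simp add: star_scaleC mult_scaleC_left mult_scaleC_right mult.assoc)
  then have "(norm2 (c *\<^sub>C a))\<^sup>2 = (cmod c * norm2 a)\<^sup>2"
    by (simp add: norm2_square power_mult_distrib flip: of_real_power)
  then show ?thesis by simp
qed

lemma norm2_scaleR: "norm2 (r *\<^sub>R a) = \<bar>r\<bar> * norm2 a"
  using norm2_scaleC[of "of_real r" a] by (simp add: scaleC_of_real)

lemma norm2_minus_commute: "norm2 (a - b) = norm2 (b - a)"
  using norm2_scaleR[of "-1" "a - b"] by simp

lemma norm2_diff_square: "(norm2 (a - b))\<^sup>2 = (norm2 a)\<^sup>2 + (norm2 b)\<^sup>2 - 2 * Re (\<tau> (star a * b))"
proof -
  have "\<tau> (star b * a) = cnj (\<tau> (star a * b))"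
    using tau_star[of "star a * b"] by (simp add: star_mult)
  then show ?thesis by (simp add: norm2_square star_diff algebra_simps)
qed

lemma norm2_Cauchy_Schwarz: "cmod (\<tau> (star a * b)) \<le> norm2 a * norm2 b"
proof -
  have real: "Re (\<tau> (star a * b)) \<le> norm2 a * norm2 b" for a b
  proof (cases "a = 0 \<or> b = 0")
    case False
    define s t where "s = norm2 a" "t = norm2 b"
    have "s \<noteq> 0" "t \<noteq> 0" "0 \<le> s" "0 \<le> t"
      using False by (simp_all add: s_t_def)
    then have pos: "0 < s * t" by simp
    have "0 \<le> (norm2 (t *\<^sub>R a - s *\<^sub>R b))\<^sup>2" by simp
    also have "\<dots> = 2 * (s * t) * (s * t) - 2 * (s * t) * Re (\<tau> (star a * b))"
      unfolding norm2_diff_square norm2_scaleR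
      by (simp add: s_t_def power_mult_distrib power2_eq_square algebra_simps)
    finally have "(s * t) * Re (\<tau> (star a * b)) \<le> (s * t) * (s * t)" by simp
    then show ?thesis using mult_le_cancel_left_pos[OF pos] by (simp add: s_t_def)
  qed auto
  define c where "c = \<tau> (star a * b)"
  show ?thesis
  proof (cases "c = 0")
    case False
    define u where "u = cnj c / of_real (cmod c)"
    have "cmod u = 1" using False by (simp add: u_def norm_divide)
    have "u * c = of_real (cmod c)"
      using False by (simp add: u_def complex_norm_square[symmetric] mult.commute power2_eq_square)
    then have "cmod c = Re (\<tau> (star a * (u *\<^sub>C b)))"
      by (simp add: mult_scaleC_right c_def)
    also have "\<dots> \<le> norm2 a * norm2 (u *\<^sub>C b)" by (rule real)
    finally show ?thesis by (simp add: norm2_scaleC \<open>cmod u = 1\<close> c_def)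
  qed (simp add: c_def)
qed

lemma norm2_triangle: "norm2 (a + b) \<le> norm2 a + norm2 b"
proof (rule power2_le_imp_le)
  have "- Re (\<tau> (star a * (- b))) \<le> norm2 a * norm2 b"
    using norm2_Cauchy_Schwarz[of a b] complex_Re_le_cmod[of "\<tau> (star a * b)"] by simp
  then show "(norm2 (a + b))\<^sup>2 \<le> (norm2 a + norm2 b)\<^sup>2"
    using norm2_diff_square[of a "- b"] norm2_scaleR[of "-1" b]
    by (simp add: power2_sum)
qed simp

text \<open>The spectrum of \<open>star k * k\<close> is bounded by \<open>(norm k)\<^sup>2\<close>, so \<open>(norm k)\<^sup>2 - star k * k\<close> has
  a square root \<open>r\<close>, and the difference of the squares of the two sides is \<open>(norm2 (r * a))\<^sup>2\<close>.\<close>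

lemma norm2_mult_left: "norm2 (k * a) \<le> norm k * norm2 a"
proof (rule power2_le_imp_le)
  have "star (star k * k) = star k * k" by (simp add: star_mult)
  then obtain S e where "spectral_resolution S e" and k: "star k * k = calc S e (\<lambda>\<alpha>. \<alpha>)"
    using spectral_theorem[OF finite_dimensional] by blast
  then interpret spectral_resolution S e by simp
  define r where "r = calc S e (\<lambda>\<alpha>. sqrt ((norm k)\<^sup>2 - \<alpha>))"
  have "r * r = calc S e (\<lambda>\<alpha>. (norm k)\<^sup>2 * 1 - \<alpha>)"
    unfolding r_def calc_mult
    by (rule calc_cong)
      (use abs_calc_le_norm[of _ "\<lambda>\<alpha>. \<alpha>"] in \<open>force simp: cstar_identity simp flip: k\<close>)
  also have "\<dots> = (norm k)\<^sup>2 *\<^sub>R 1 - star k * k"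
    unfolding calc_diff k by (simp add: calc_def complete flip: scaleR_sum_right)
  finally have rr: "r * r = (norm k)\<^sup>2 *\<^sub>R 1 - star k * k" .
  have "star (r * a) * (r * a) = star a * (r * r) * a"
    by (simp add: star_mult r_def mult.assoc)
  also have "\<dots> = (norm k)\<^sup>2 *\<^sub>R (star a * a) - star (k * a) * (k * a)"
    by (simp add: rr algebra_simps star_mult)
  finally have "(norm2 (r * a))\<^sup>2 = (norm k)\<^sup>2 * (norm2 a)\<^sup>2 - (norm2 (k * a))\<^sup>2"
    by (simp add: norm2_square)
  then show "(norm2 (k * a))\<^sup>2 \<le> (norm k * norm2 a)\<^sup>2"
    by (simp add: power_mult_distrib) (metis diff_ge_0_iff_ge zero_le_power2)
qed simp

lemma norm2_mult_right: "norm2 (a * k) \<le> norm2 a * norm k"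
  using norm2_mult_left[of "star k" "star a"] by (simp add: mult.commute flip: star_mult)

section \<open>The polar decomposition and the trace norm\<close>

text \<open>A negative eigenvalue of \<open>star c * c\<close> is detected by its spectral projection
  \<open>e \<alpha>\<close>, since \<open>(norm2 (c * e \<alpha>))\<^sup>2 = \<alpha> * (norm2 (e \<alpha>))\<^sup>2\<close> cannot be negative.\<close>

lemma positive_star_mult_self:
  fixes c :: 'a
  shows "positive (star c * c)"
proof -
  have "star (star c * c) = star c * c" by (simp add: star_mult)
  then obtain S e where "spectral_resolution S e" and c: "star c * c = calc S e (\<lambda>\<alpha>. \<alpha>)"
    using spectral_theorem[OF finite_dimensional] by blast
  then interpret spectral_resolution S e by simp
  have "0 \<le> \<alpha>" if "\<alpha> \<in> S" for \<alpha>
  proof -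
    have "star (c * e \<alpha>) * (c * e \<alpha>) = e \<alpha> * ((star c * c) * e \<alpha>)"
      using that by (simp add: star_mult selfadjoint mult.assoc)
    also have "\<dots> = \<alpha> *\<^sub>R (star (e \<alpha>) * e \<alpha>)"
      using that by (simp add: c calc_mult_projection selfadjoint)
    finally have "(norm2 (c * e \<alpha>))\<^sup>2 = \<alpha> * (norm2 (e \<alpha>))\<^sup>2" by (simp add: norm2_square)
    moreover have "0 < (norm2 (e \<alpha>))\<^sup>2" using nonzero[OF that] by simp
    ultimately show ?thesis by (metis zero_le_mult_iff zero_le_power2 not_less)
  qed
  then show ?thesis by (simp add: c positive_calc_iff)
qed

lemma cstar_abs_positive:
  fixes c :: 'a
  shows "positive (cstar_abs c)" "cstar_abs c * cstar_abs c = star c * c"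
  using cstar_sqrt_positive[OF finite_dimensional positive_star_mult_self[of c]]
  by (simp_all add: cstar_abs_def)

text \<open>\<open>\<tau> (a * b) = \<tau> (star (s * t) * (s * t))\<close> for the square roots \<open>s\<close> and \<open>t\<close>.\<close>

lemma tau_mult_positive:
  assumes "positive a" "positive b"
  shows "\<tau> (a * b) \<in> \<real>\<^sub>\<ge>\<^sub>0"
proof -
  define s t where "s = cstar_sqrt a" "t = cstar_sqrt b"
  have st: "star s = s" "star t = t" "s * s = a" "t * t = b"
    using cstar_sqrt_positive[OF finite_dimensional] assms by (auto simp: s_t_def positive_def)
  have "\<tau> (a * b) = \<tau> (t * (s * s * t))"
    unfolding st(3,4)[symmetric] by (metis mult.assoc tau_commute)
  also have "\<dots> = \<tau> (star (s * t) * (s * t))" by (simp add: star_mult st(1,2) mult.assoc)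
  finally show ?thesis using tau_star_mult_self_nonneg[of "s * t"] by simp
qed

definition partial_isometry :: "'a \<Rightarrow> bool" where
  "partial_isometry k \<longleftrightarrow> k * star k * k = k"

lemma partial_isometry_norm:
  assumes "partial_isometry k"
  shows "norm k \<le> 1"
proof -
  have "star (star k * k) * (star k * k) = star k * k"
    using assms by (simp add: star_mult partial_isometry_def mult.assoc)
  then have "((norm k)\<^sup>2)\<^sup>2 = (norm k)\<^sup>2" by (metis cstar_identity)
  then have "(norm k)\<^sup>2 * (norm k)\<^sup>2 = (norm k)\<^sup>2 * 1" by (simp add: power2_eq_square)
  then have "(norm k)\<^sup>2 \<le> 1\<^sup>2" unfolding mult_cancel_left by auto
  then show ?thesis by (rule power2_le_imp_le) simp
qed

text \<open>The partial isometry is \<open>c * inverse \<bar>c\<bar>\<close>, the inverse being taken on the support of \<open>\<bar>c\<bar>\<close>;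
  this is the functional calculus for \<open>inverse\<close> because \<open>inverse 0 = 0\<close>.\<close>

lemma polar_decomposition:
  obtains v where "partial_isometry v" "c = v * cstar_abs c" "star v * c = cstar_abs c"
proof -
  obtain S e where "spectral_resolution S e" and s: "cstar_abs c = calc S e (\<lambda>\<alpha>. \<alpha>)"
    using positive_cases[OF finite_dimensional cstar_abs_positive(1)] by blast
  then interpret spectral_resolution S e by simp
  define g where "g = calc S e inverse"
  define p where "p = calc S e (\<lambda>\<alpha>. \<alpha> * inverse \<alpha>)"
  define v where "v = c * g"
  have cc: "star c * c = calc S e (\<lambda>\<alpha>. \<alpha> * \<alpha>)"
    by (simp add: s calc_mult flip: cstar_abs_positive(2))
  have cp: "c * p = c"
  proof -
    have "star (c * (1 - p)) * (c * (1 - p)) = (1 - p) * (star c * c) * (1 - p)"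
      by (simp add: star_mult star_diff p_def mult.assoc)
    also have "\<dots> = calc S e (\<lambda>\<alpha>. (1 - \<alpha> * inverse \<alpha>) * (\<alpha> * \<alpha>) * (1 - \<alpha> * inverse \<alpha>))"
      by (simp add: cc p_def calc_mult flip: calc_one calc_diff)
    also have "\<dots> = calc S e (\<lambda>\<alpha>. 0)"
    proof (rule calc_cong)
      show "(1 - \<alpha> * inverse \<alpha>) * (\<alpha> * \<alpha>) * (1 - \<alpha> * inverse \<alpha>) = 0" for \<alpha> :: real
        by (cases "\<alpha> = 0") auto
    qed
    also have "\<dots> = 0" by (simp add: calc_def)
    finally have "c * (1 - p) = 0" by simp
    then show ?thesis by (simp add: algebra_simps)
  qed
  have "c = v * cstar_abs c"
    using cp by (simp add: v_def g_def s mult.assoc calc_mult p_def mult.commute)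
  moreover have vc: "star v * c = cstar_abs c"
  proof -
    have "star v * c = g * (star c * c)" by (simp add: v_def star_mult g_def mult.assoc)
    also have "\<dots> = calc S e (\<lambda>\<alpha>. inverse \<alpha> * (\<alpha> * \<alpha>))" by (simp add: cc g_def calc_mult)
    also have "\<dots> = cstar_abs c" unfolding s by (rule calc_cong) (simp, metis left_inverse)
    finally show ?thesis .
  qed
  moreover have "partial_isometry v"
  proof -
    have "v * star v * v = v * (cstar_abs c * g)"
      by (simp add: v_def mult.assoc flip: vc)
    also have "\<dots> = c * (g * (cstar_abs c * g))" by (simp add: v_def mult.assoc)
    also have "g * (cstar_abs c * g) = g"
      unfolding g_def s calc_mult by (rule calc_cong) (simp, metis right_inverse)
    finally show ?thesis by (simp add: partial_isometry_def v_def)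
  qed
  ultimately show thesis by (intro that)
qed

definition trace_norm :: "'a \<Rightarrow> real" where
  "trace_norm c = Re (\<tau> (cstar_abs c))"

text \<open>The duality between the operator norm and the trace norm. With \<open>c = v * \<bar>c\<bar>\<close> and
  \<open>r = \<surd>\<bar>c\<bar>\<close> one has \<open>\<tau> (k * c) = \<tau> (r * (k * v * r))\<close>, and the Cauchy--Schwarz inequality
  bounds this by \<open>(norm2 r)\<^sup>2 = \<tau> \<bar>c\<bar>\<close>.\<close>

lemma trace_norm_ge:
  assumes "norm k \<le> 1"
  shows "cmod (\<tau> (k * c)) \<le> trace_norm c"
proof -
  obtain v where v: "partial_isometry v" "c = v * cstar_abs c" by (rule polar_decomposition)
  define r where "r = cstar_sqrt (cstar_abs c)"
  have r: "star r = r" "r * r = cstar_abs c"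
    using cstar_sqrt_positive[OF finite_dimensional cstar_abs_positive(1)]
    by (auto simp: r_def positive_def)
  have "\<tau> (k * c) = \<tau> ((k * v * r) * r)"
    by (subst v(2)) (simp add: mult.assoc flip: r(2))
  also have "\<dots> = \<tau> (star r * (k * v * r))" by (simp add: r(1) tau_commute)
  finally have "cmod (\<tau> (k * c)) \<le> norm2 r * norm2 (k * v * r)"
    using norm2_Cauchy_Schwarz by metis
  also have "norm2 (k * v * r) \<le> norm (k * v) * norm2 r" by (rule norm2_mult_left)
  also have "\<dots> \<le> 1 * norm2 r"
    using order_trans[OF norm_mult_ineq[of k v] mult_le_one[OF assms _ partial_isometry_norm[OF v(1)]]]
    by (intro mult_right_mono) simp_all
  also have "norm2 r * (1 * norm2 r) = (norm2 r)\<^sup>2" by (simp add: power2_eq_square)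
  also have "\<dots> = trace_norm c" by (simp add: norm2_square r trace_norm_def)
  finally show ?thesis by (simp add: mult_left_mono)
qed

lemma trace_norm_attained:
  obtains k where "partial_isometry k" "Re (\<tau> (star k * c)) = trace_norm c"
  using polar_decomposition[of c] by (metis trace_norm_def)

text \<open>By duality, as \<open>\<tau> (star k * star d)\<close> is the conjugate of \<open>\<tau> (k * d)\<close>.\<close>

lemma trace_norm_star: "trace_norm (star c) = trace_norm c"
proof -
  have le: "trace_norm (star d) \<le> trace_norm d" for d
  proof -
    obtain k where k: "partial_isometry k" "Re (\<tau> (star k * star d)) = trace_norm (star d)"
      by (rule trace_norm_attained)
    have "\<tau> (star k * star d) = cnj (\<tau> (k * d))"
      using tau_star[of "d * k"] by (simp add: star_mult tau_commute[of k])
    with k(2) have "trace_norm (star d) = Re (\<tau> (k * d))" by simp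
    also have "\<dots> \<le> cmod (\<tau> (k * d))" by (rule complex_Re_le_cmod)
    also have "\<dots> \<le> trace_norm d" using trace_norm_ge partial_isometry_norm k(1) by blast
    finally show ?thesis .
  qed
  show ?thesis using le[of c] le[of "star c"] by simp
qed


section \<open>The Bures metric\<close>

lemma cstar_sqrt_density:
  assumes "x \<in> density_space \<tau>"
  shows "star (cstar_sqrt x) = cstar_sqrt x" "cstar_sqrt x * cstar_sqrt x = x"
    "norm2 (cstar_sqrt x) = 1"
proof -
  have x: "positive x" "\<tau> x = 1" using assms by (simp_all add: density_space_def)
  show sa: "star (cstar_sqrt x) = cstar_sqrt x" and sq: "cstar_sqrt x * cstar_sqrt x = x"
    using cstar_sqrt_positive[OF finite_dimensional x(1)] by (simp_all add: positive_def)
  show "norm2 (cstar_sqrt x) = 1" by (simp add: norm2_def sa sq x(2))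
qed

lemma bures_metric_trace_norm:
  "bures_metric \<tau> x y = sqrt (1 - trace_norm (cstar_sqrt x * cstar_sqrt y))"
  by (simp add: bures_metric_def trace_norm_def)

lemma trace_norm_mult_le: "trace_norm (star a * b) \<le> norm2 a * norm2 b"
proof -
  obtain k where k: "partial_isometry k" "Re (\<tau> (star k * (star a * b))) = trace_norm (star a * b)"
    by (rule trace_norm_attained)
  have "trace_norm (star a * b) = Re (\<tau> (star (a * k) * b))"
    by (simp add: star_mult mult.assoc flip: k(2))
  also have "\<dots> \<le> norm2 (a * k) * norm2 b"
    using norm2_Cauchy_Schwarz complex_Re_le_cmod order_trans by blast
  also have "\<dots> \<le> (norm2 a * norm k) * norm2 b"
    by (intro mult_right_mono norm2_mult_right) simp
  also have "\<dots> \<le> (norm2 a * 1) * norm2 b"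
    by (intro mult_right_mono mult_left_mono partial_isometry_norm k) simp_all
  finally show ?thesis by simp
qed

lemma bures_metric_square:
  assumes "x \<in> density_space \<tau>" "y \<in> density_space \<tau>"
  shows "(bures_metric \<tau> x y)\<^sup>2 = 1 - trace_norm (cstar_sqrt x * cstar_sqrt y)"
  using trace_norm_mult_le[of "cstar_sqrt x" "cstar_sqrt y"] cstar_sqrt_density assms
  by (simp add: bures_metric_trace_norm)

lemma bures_metric_nonneg:
  assumes "x \<in> density_space \<tau>" "y \<in> density_space \<tau>"
  shows "0 \<le> bures_metric \<tau> x y"
  using trace_norm_mult_le[of "cstar_sqrt x" "cstar_sqrt y"] cstar_sqrt_density assms
  by (simp add: bures_metric_trace_norm)

lemma bures_metric_commute:
  assumes "x \<in> density_space \<tau>" "y \<in> density_space \<tau>"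
  shows "bures_metric \<tau> x y = bures_metric \<tau> y x"
  using trace_norm_star[of "cstar_sqrt x * cstar_sqrt y"] cstar_sqrt_density assms
  by (simp add: bures_metric_trace_norm star_mult)

lemma bures_metric_self:
  assumes "x \<in> density_space \<tau>"
  shows "bures_metric \<tau> x x = 0"
proof -
  have x: "positive x" "\<tau> x = 1" using assms by (simp_all add: density_space_def)
  then have "cstar_abs x = x"
    unfolding cstar_abs_def by (intro cstar_sqrt_eqI[OF finite_dimensional]) (simp_all add: positive_def)
  then show ?thesis by (simp add: bures_metric_def cstar_sqrt_density[OF assms] x)
qed

lemma partial_isometry_complement:
  assumes "partial_isometry k"
  shows "star (1 - k * star k) = 1 - k * star k"
    "(1 - k * star k) * (1 - k * star k) = 1 - k * star k"
proof -
  have "(k * star k) * (k * star k) = (k * star k * k) * star k" by (simp add: mult.assoc)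
  also have "\<dots> = k * star k" using assms by (simp add: partial_isometry_def)
  finally show "(1 - k * star k) * (1 - k * star k) = 1 - k * star k"
    by (simp add: left_diff_distrib right_diff_distrib)
qed (simp add: star_diff star_mult)

text \<open>\<open>k * star k\<close> is a projection, and \<open>w\<close> is split along it and its complement.\<close>

lemma partial_isometry_Pythagoras:
  assumes "partial_isometry k"
  shows "(norm2 (w * k))\<^sup>2 + (norm2 (w * (1 - k * star k)))\<^sup>2 = (norm2 w)\<^sup>2"
proof -
  define m where "m = 1 - k * star k"
  have m: "star m = m" "m * m = m"
    unfolding m_def by (rule partial_isometry_complement[OF assms])+
  have "\<tau> (star (w * k) * (w * k)) = \<tau> (star w * w * (k * star k))"
    using tau_commute[of "star k" "star w * w * k"] by (simp add: star_mult mult.assoc)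
  moreover have "\<tau> (star (w * m) * (w * m)) = \<tau> (star w * w * (m * m))"
    using tau_commute[of m "star w * w * m"] by (simp add: star_mult m mult.assoc)
  moreover have "star w * w * (k * star k) + star w * w * (m * m) = star w * w"
    unfolding m by (simp add: m_def algebra_simps)
  ultimately have "\<tau> (star (w * k) * (w * k)) + \<tau> (star (w * m) * (w * m)) = \<tau> (star w * w)"
    by (metis tau_linear(2))
  then show ?thesis by (simp add: norm2_square flip: m_def plus_complex.sel(1))
qed

text \<open>The right-hand side is the squared distance between \<open>(b, 0)\<close> and
  \<open>(a * k, a * (1 - k * star k))\<close>, which purify the two densities. The partial isometry \<open>k\<close> comes
  from a polar decomposition; adding the second component restores the unit norm that \<open>a * k\<close>
  may lose, so \<open>k\<close> need not be extended to a unitary.\<close>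

lemma bures_metric_coupling:
  assumes "x \<in> density_space \<tau>" "y \<in> density_space \<tau>"
  defines "a \<equiv> cstar_sqrt x" and "b \<equiv> cstar_sqrt y"
  obtains k where "partial_isometry k"
    "2 * (bures_metric \<tau> x y)\<^sup>2 = (norm2 (b - a * k))\<^sup>2 + (norm2 (a * (1 - k * star k)))\<^sup>2"
proof -
  note a = cstar_sqrt_density[OF assms(1), folded a_def]
  note b = cstar_sqrt_density[OF assms(2), folded b_def]
  obtain k where k: "partial_isometry k" "Re (\<tau> (star k * (a * b))) = trace_norm (a * b)"
    by (rule trace_norm_attained)
  have "(norm2 (b - a * k))\<^sup>2 = (norm2 (a * k))\<^sup>2 + 1 - 2 * trace_norm (a * b)"
    using k(2) by (simp add: norm2_minus_commute[of b] norm2_diff_square b star_mult a mult.assoc)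
  moreover have "(norm2 (a * k))\<^sup>2 + (norm2 (a * (1 - k * star k)))\<^sup>2 = 1"
    using partial_isometry_Pythagoras[OF k(1), of a] by (simp add: a)
  moreover have "(bures_metric \<tau> x y)\<^sup>2 = 1 - trace_norm (a * b)"
    unfolding a_def b_def by (rule bures_metric_square[OF assms(1,2)])
  ultimately show thesis by (intro that[OF k(1)]) simp
qed

text \<open>Any contraction, not only an optimal one, bounds the Bures distance from above; this is
  applied to products of optimal partial isometries and to the unit.\<close>

lemma bures_metric_le:
  assumes "x \<in> density_space \<tau>" "y \<in> density_space \<tau>" "norm k \<le> 1"
  shows "2 * (bures_metric \<tau> x y)\<^sup>2 \<le> 2 - 2 * Re (\<tau> (star k * (cstar_sqrt x * cstar_sqrt y)))"
proof -
  have "Re (\<tau> (star k * (cstar_sqrt x * cstar_sqrt y))) \<le> trace_norm (cstar_sqrt x * cstar_sqrt y)"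
    using trace_norm_ge[of "star k"] assms(3) complex_Re_le_cmod order_trans by (metis norm_star)
  then show ?thesis by (simp add: bures_metric_square[OF assms(1,2)])
qed

text \<open>Optimal couplings \<open>k\<close> from \<open>x\<close> to \<open>y\<close> and \<open>l\<close> from \<open>y\<close> to \<open>z\<close> compose to a coupling
  \<open>k * l\<close>, whose dilation has the three components \<open>a * k * l\<close>, \<open>a * k * (1 - l * star l)\<close> and
  \<open>a * (1 - k * star k)\<close>. Its difference from \<open>(c, 0, 0)\<close> is the sum of the two dilated
  differences, and the triangle inequality of the Euclidean norm applies.\<close>

lemma bures_metric_triangle:
  assumes D: "x \<in> density_space \<tau>" "y \<in> density_space \<tau>" "z \<in> density_space \<tau>"
  shows "bures_metric \<tau> x z \<le> bures_metric \<tau> x y + bures_metric \<tau> y z"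
proof -
  define a b c where "a = cstar_sqrt x" "b = cstar_sqrt y" "c = cstar_sqrt z"
  note a = cstar_sqrt_density[OF D(1), folded a_b_c_def]
  note c = cstar_sqrt_density[OF D(3), folded a_b_c_def]
  obtain k where k: "partial_isometry k"
    "2 * (bures_metric \<tau> x y)\<^sup>2 = (norm2 (b - a * k))\<^sup>2 + (norm2 (a * (1 - k * star k)))\<^sup>2"
    using bures_metric_coupling[OF D(1,2)] unfolding a_b_c_def by blast
  obtain l where l: "partial_isometry l"
    "2 * (bures_metric \<tau> y z)\<^sup>2 = (norm2 (c - b * l))\<^sup>2 + (norm2 (b * (1 - l * star l)))\<^sup>2"
    using bures_metric_coupling[OF D(2,3)] unfolding a_b_c_def by blast
  define r where "r = b - a * k"
  define m where "m = 1 - l * star l"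
  define \<alpha>1 \<beta>1 where "\<alpha>1 = norm2 (c - b * l)" "\<beta>1 = norm2 (b * m)"
  define \<alpha>2 \<beta>2 \<gamma> where "\<alpha>2 = norm2 (r * l)" "\<beta>2 = norm2 (r * m)" "\<gamma> = norm2 (a * (1 - k * star k))"
  note defs = \<alpha>1_\<beta>1_def \<alpha>2_\<beta>2_\<gamma>_def
  have "norm (k * l) \<le> 1"
    using order_trans[OF norm_mult_ineq[of k l] mult_le_one] partial_isometry_norm k(1) l(1) by simp
  then have "2 * (bures_metric \<tau> x z)\<^sup>2 \<le> 2 - 2 * Re (\<tau> (star (k * l) * (a * c)))"
    unfolding a_b_c_def by (rule bures_metric_le[OF D(1,3)])
  also have "\<dots> = (norm2 (c - a * k * l))\<^sup>2 + (norm2 (a * k * m))\<^sup>2 + \<gamma>\<^sup>2"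
    using partial_isometry_Pythagoras[OF k(1), of a] partial_isometry_Pythagoras[OF l(1), of "a * k"]
    by (simp add: norm2_minus_commute[of c] norm2_diff_square a c star_mult m_def defs mult.assoc)
  also have "\<dots> \<le> (\<alpha>1 + \<alpha>2)\<^sup>2 + (\<beta>1 + \<beta>2)\<^sup>2 + \<gamma>\<^sup>2"
  proof -
    have "c - a * k * l = (c - b * l) + r * l" by (simp add: r_def algebra_simps)
    then have "norm2 (c - a * k * l) \<le> \<alpha>1 + \<alpha>2"
      using norm2_triangle[of "c - b * l" "r * l"] by (simp only: defs)
    moreover have "a * k * m = b * m - r * m" by (simp add: r_def algebra_simps)
    then have "norm2 (a * k * m) \<le> \<beta>1 + \<beta>2"
      using norm2_triangle[of "b * m" "- (r * m)"] norm2_scaleR[of "-1" "r * m"] by (simp add: defs)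
    ultimately show ?thesis by (intro add_mono power_mono) (simp_all add: defs)
  qed
  finally have "sqrt (2 * (bures_metric \<tau> x z)\<^sup>2) \<le> norm (\<alpha>1 + \<alpha>2, \<beta>1 + \<beta>2, \<gamma>)"
    by (simp add: norm_Pair)
  also have "\<dots> = norm ((\<alpha>1, \<beta>1, 0) + (\<alpha>2, \<beta>2, \<gamma>))" by simp
  also have "\<dots> \<le> norm (\<alpha>1, \<beta>1, 0 :: real) + norm (\<alpha>2, \<beta>2, \<gamma>)" by (rule norm_triangle_ineq)
  also have "norm (\<alpha>1, \<beta>1, 0 :: real) = sqrt (2 * (bures_metric \<tau> y z)\<^sup>2)"
    unfolding l(2) by (simp add: norm_Pair defs m_def)
  also have "norm (\<alpha>2, \<beta>2, \<gamma>) = sqrt (2 * (bures_metric \<tau> x y)\<^sup>2)"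
    using partial_isometry_Pythagoras[OF l(1), of r]
    unfolding k(2) by (simp add: norm_Pair defs m_def r_def)
  finally have "sqrt 2 * bures_metric \<tau> x z \<le> sqrt 2 * (bures_metric \<tau> x y + bures_metric \<tau> y z)"
    by (simp add: real_sqrt_mult bures_metric_nonneg D algebra_simps)
  then show ?thesis by simp
qed

text \<open>One of the Fuchs--van de Graaf inequalities. With an optimal coupling \<open>k\<close>,
  \<open>r = b - a * k\<close> and the projection \<open>m = 1 - k * star k\<close>,
  \<open>y - x = r * b + a * k * star r - (a * m) * star (a * m)\<close>, where \<open>r\<close> and \<open>a * m\<close>
  are at most \<open>\<surd>2\<close> times the Bures distance in the Hilbert--Schmidt norm.\<close>

lemma tau_diff_le_bures_metric:
  assumes D: "x \<in> density_space \<tau>" "y \<in> density_space \<tau>"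
  shows "cmod (\<tau> (y * w) - \<tau> (x * w)) \<le> 3 * (sqrt 2 * bures_metric \<tau> x y) * norm w"
proof -
  define a b where "a = cstar_sqrt x" "b = cstar_sqrt y"
  note a = cstar_sqrt_density[OF D(1), folded a_b_def]
  note b = cstar_sqrt_density[OF D(2), folded a_b_def]
  obtain k where k: "partial_isometry k"
    "2 * (bures_metric \<tau> x y)\<^sup>2 = (norm2 (b - a * k))\<^sup>2 + (norm2 (a * (1 - k * star k)))\<^sup>2"
    using bures_metric_coupling[OF D] unfolding a_b_def by blast
  define r m where "r = b - a * k" "m = 1 - k * star k"
  define \<delta> where "\<delta> = sqrt 2 * bures_metric \<tau> x y"
  have "0 \<le> \<delta>" by (simp add: \<delta>_def bures_metric_nonneg D)
  have sq: "\<delta>\<^sup>2 = (norm2 r)\<^sup>2 + (norm2 (a * m))\<^sup>2" by (simp add: \<delta>_def r_m_def power_mult_distrib k(2))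
  have r: "norm2 r \<le> \<delta>"
    by (rule power2_le_imp_le) (simp_all add: sq \<open>0 \<le> \<delta>\<close>)
  have am: "norm2 (a * m) \<le> \<delta>"
    by (rule power2_le_imp_le) (simp_all add: sq \<open>0 \<le> \<delta>\<close>)
  have le: "cmod (\<tau> (u * v * w)) \<le> \<delta> * norm w"
    if "norm2 u * norm2 v \<le> \<delta>" for u v
  proof -
    have "cmod (\<tau> (star (star u) * (v * w))) \<le> norm2 (star u) * norm2 (v * w)"
      by (rule norm2_Cauchy_Schwarz)
    also have "\<dots> \<le> norm2 u * (norm2 v * norm w)"
      by (simp add: mult_left_mono norm2_mult_right)
    also have "\<dots> \<le> \<delta> * norm w" using that by (simp add: mult_right_mono flip: mult.assoc)
    finally show ?thesis by (simp add: mult.assoc)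
  qed
  have "star m = m" "m * m = m"
    unfolding r_m_def by (rule partial_isometry_complement[OF k(1)])+
  have am1: "norm2 (a * m) \<le> 1"
    using partial_isometry_Pythagoras[OF k(1), of a]
    by (intro power2_le_imp_le[OF _ zero_le_one])
      (simp only: a r_m_def, smt (verit) zero_le_power2 power_one)
  have ak1: "norm2 (a * k) \<le> 1"
    using partial_isometry_Pythagoras[OF k(1), of a]
    by (intro power2_le_imp_le[OF _ zero_le_one])
      (simp only: a, smt (verit) zero_le_power2 power_one)
  have "y - x = r * b + (a * k) * star r - (a * m) * star (a * m)"
  proof -
    have "(a * m) * star (a * m) = a * (m * m) * a"
      by (simp add: star_mult a \<open>star m = m\<close> mult.assoc)
    also have "\<dots> = x - a * k * star k * a"
      unfolding \<open>m * m = m\<close> by (simp add: r_m_def algebra_simps a)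
    finally show ?thesis by (simp add: r_m_def star_diff star_mult a(1) b(1,2) algebra_simps)
  qed
  then have "y * w - x * w = r * b * w + (a * k) * star r * w - (a * m) * star (a * m) * w"
    by (simp only: left_diff_distrib[symmetric] distrib_right[symmetric])
  then have "\<tau> (y * w) - \<tau> (x * w)
      = \<tau> (r * b * w) + \<tau> ((a * k) * star r * w) - \<tau> ((a * m) * star (a * m) * w)"
    by (simp only: tau_linear(2,3)[symmetric])
  also have "cmod \<dots> \<le> cmod (\<tau> (r * b * w)) + cmod (\<tau> ((a * k) * star r * w))
      + cmod (\<tau> ((a * m) * star (a * m) * w))"
    by (intro order_trans[OF norm_triangle_ineq4] add_mono norm_triangle_ineq order_refl)
  also have "\<dots> \<le> \<delta> * norm w + \<delta> * norm w + \<delta> * norm w"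
  proof (intro add_mono le)
    show "norm2 r * norm2 b \<le> \<delta>" using r b by simp
    show "norm2 (a * k) * norm2 (star r) \<le> \<delta>"
      using mult_mono[OF ak1 r] by simp
    show "norm2 (a * m) * norm2 (star (a * m)) \<le> \<delta>"
      using mult_mono[OF am am1] \<open>0 \<le> \<delta>\<close> by simp
  qed
  finally show ?thesis by (simp add: \<delta>_def algebra_simps)
qed

lemma tau_mult_inject:
  assumes "\<And>w. \<tau> (x * w) = \<tau> (y * w)"
  shows "x = y"
proof -
  have "\<tau> ((x - y) * star (x - y)) = 0" using assms by (simp add: left_diff_distrib)
  then have "norm2 (star (x - y)) = 0" by (simp add: norm2_def)
  then show ?thesis by simp
qed

lemma bures_metric_eq_0_iff:
  assumes "x \<in> density_space \<tau>" "y \<in> density_space \<tau>"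
  shows "bures_metric \<tau> x y = 0 \<longleftrightarrow> x = y"
proof
  assume "bures_metric \<tau> x y = 0"
  then show "x = y"
    using tau_diff_le_bures_metric[OF assms] by (intro tau_mult_inject) simp
qed (use bures_metric_self assms in simp)

text \<open>The Powers--Stormer inequality. With \<open>s = a - b\<close>, \<open>t = a + b\<close> and \<open>E\<close> the sign of \<open>s\<close>,
  \<open>2 (a\<^sup>2 - b\<^sup>2) = s * t + t * s\<close> gives \<open>\<tau> ((a\<^sup>2 - b\<^sup>2) * E) = \<tau> (t * \<bar>s\<bar>)\<close>. As \<open>t - s\<close> and
  \<open>t + s\<close> are positive, pairing them with the positive and the negative part of \<open>s\<close>
  shows that this is at least \<open>\<tau> (s\<^sup>2)\<close>.\<close>

lemma norm2_diff_le_squares: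
  assumes "positive a" "positive b"
  shows "(norm2 (a - b))\<^sup>2 \<le> norm2 (a * a - b * b) * norm2 1"
proof -
  define s t where "s = a - b" "t = a + b"
  have ss: "star s = s" using assms by (simp add: s_t_def positive_def star_diff)
  obtain S e where "spectral_resolution S e" and s: "s = calc S e (\<lambda>\<alpha>. \<alpha>)"
    using spectral_theorem[OF finite_dimensional ss] .
  then interpret spectral_resolution S e by simp
  define E P where "E = calc S e sgn" "P = calc S e abs"
  define p n where "p = calc S e (\<lambda>\<alpha>. max \<alpha> 0)" "n = calc S e (\<lambda>\<alpha>. max (- \<alpha>) 0)"
  have E: "star E = E" "E * s = P" "s * E = P"
    by (auto simp: E_P_def s calc_mult sgn_mult_abs abs_sgn mult.commute intro!: calc_cong)
  have s_pn: "s = p - n" and P_pn: "P = p + n"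
    by (auto simp: s p_n_def E_P_def simp flip: calc_diff calc_add intro!: calc_cong)
  have "0 \<le> Re (\<tau> (2 *\<^sub>R b * p)) + Re (\<tau> (2 *\<^sub>R a * n))"
    using tau_mult_positive[OF assms(2), of p] tau_mult_positive[OF assms(1), of n]
    by (simp add: p_n_def positive_calc_iff complex_nonneg_Reals_iff)
  also have "2 *\<^sub>R b * p = (t - s) * p" by (simp add: s_t_def scaleR_2)
  also have "2 *\<^sub>R a * n = (t + s) * n" by (simp add: s_t_def scaleR_2)
  also have "Re (\<tau> ((t - s) * p)) + Re (\<tau> ((t + s) * n)) = Re (\<tau> (t * P)) - Re (\<tau> (s * s))"
    by (simp add: P_pn s_pn algebra_simps)
  finally have "(norm2 s)\<^sup>2 \<le> Re (\<tau> (t * P))" by (simp add: norm2_square ss)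
  also have "\<tau> (t * P) = \<tau> ((a * a - b * b) * E)"
  proof -
    have "2 *\<^sub>R (a * a - b * b) = s * t + t * s" by (simp add: s_t_def algebra_simps scaleR_2)
    then have "2 * \<tau> ((a * a - b * b) * E) = \<tau> (s * t * E) + \<tau> (t * s * E)"
      by (metis distrib_right mult_scaleR_left of_real_numeral tau_linear(2,6))
    also have "\<tau> (s * t * E) = \<tau> (t * P)"
      using tau_commute[of s "t * E"] by (simp add: mult.assoc E)
    also have "\<tau> (t * s * E) = \<tau> (t * P)" by (simp add: mult.assoc E)
    finally show ?thesis by simp
  qed
  also have "Re \<dots> \<le> cmod \<dots>" by (rule complex_Re_le_cmod)
  also have "\<dots> \<le> norm2 (star (a * a - b * b)) * norm2 E"
    using norm2_Cauchy_Schwarz[of "star (a * a - b * b)" E] by simp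
  also have "norm2 E \<le> norm2 1"
  proof -
    have "E * star E * E = E"
      unfolding E(1) unfolding E_P_def calc_mult by (rule calc_cong) (simp add: sgn_if)
    then have "norm E \<le> 1" by (intro partial_isometry_norm) (simp add: partial_isometry_def)
    then have "norm E * norm2 1 \<le> 1 * norm2 1" by (intro mult_right_mono) simp_all
    then show ?thesis using norm2_mult_left[of E 1] by simp
  qed
  finally show ?thesis by (simp add: s_t_def mult_left_mono)
qed

lemma bures_metric_le_norm2:
  assumes D: "x \<in> density_space \<tau>" "y \<in> density_space \<tau>"
  shows "2 * (bures_metric \<tau> x y)\<^sup>2 \<le> norm2 (x - y) * norm2 1"
proof -
  note x = cstar_sqrt_density[OF D(1)] and y = cstar_sqrt_density[OF D(2)]
  have "2 * (bures_metric \<tau> x y)\<^sup>2 \<le> (norm2 (cstar_sqrt x - cstar_sqrt y))\<^sup>2"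
    using bures_metric_le[OF D, of 1] by (simp add: norm2_diff_square x y)
  also have "\<dots> \<le> norm2 (x - y) * norm2 1"
    using norm2_diff_le_squares[of "cstar_sqrt x" "cstar_sqrt y"] D
      cstar_sqrt_positive[OF finite_dimensional]
    by (simp add: x y density_space_def)
  finally show ?thesis .
qed

section \<open>Weak convergence of densities\<close>

text \<open>Gram--Schmidt for the inner product \<open>\<tau> (star a * b)\<close>, phrased through Fourier expansions
  because these, rather than spans, enter Parseval's identity.\<close>

lemma orthonormal_family:
  assumes "finite B"
  shows "\<exists>T. finite T \<and> (\<forall>s\<in>T. \<forall>t\<in>T. \<tau> (star s * t) = (if s = t then 1 else 0)) \<and>
    (\<forall>b\<in>B. b = (\<Sum>t\<in>T. \<tau> (star t * b) *\<^sub>C t))"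
  using assms
proof (induction B)
  case empty
  show ?case by (rule exI[of _ "{}"]) simp
next
  case (insert b B)
  then obtain T where fin: "finite T"
    and orth: "\<And>s t. s \<in> T \<Longrightarrow> t \<in> T \<Longrightarrow> \<tau> (star s * t) = (if s = t then 1 else 0)"
    and expand: "\<And>b. b \<in> B \<Longrightarrow> b = (\<Sum>t\<in>T. \<tau> (star t * b) *\<^sub>C t)" by blast
  define r where "r = b - (\<Sum>t\<in>T. \<tau> (star t * b) *\<^sub>C t)"
  have r_orth: "\<tau> (star s * r) = 0" if "s \<in> T" for s
    using that fin by (simp add: r_def right_diff_distrib sum_distrib_left mult_scaleC_right orth
        if_distrib cong: if_cong)
  show ?case
  proof (cases "r = 0")
    case True
    then have "b = (\<Sum>t\<in>T. \<tau> (star t * b) *\<^sub>C t)" by (simp add: r_def)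
    then show ?thesis using fin orth expand by (intro exI[of _ T]) blast
  next
    case False
    define u where "u = inverse (norm2 r) *\<^sub>R r"
    have r: "r = norm2 r *\<^sub>R u" using False by (simp add: u_def)
    have u_orth: "\<tau> (star s * u) = 0" "\<tau> (star u * s) = 0" if "s \<in> T" for s
      using r_orth[OF that] tau_star[of "star s * r"] by (simp_all add: u_def star_mult)
    have uu: "\<tau> (star u * u) = 1"
      using False by (simp add: u_def tau_star_mult_self power2_eq_square field_simps)
    have "u \<notin> T" using u_orth uu by force
    have "\<tau> (star u * b) = \<tau> (star u * r) + (\<Sum>t\<in>T. \<tau> (star t * b) * \<tau> (star u * t))"
      by (simp add: r_def right_diff_distrib sum_distrib_left mult_scaleC_right)
    also have "\<dots> = norm2 r" using u_orth by (subst r) (simp add: uu)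
    finally have "b = (\<Sum>t\<in>insert u T. \<tau> (star t * b) *\<^sub>C t)"
      using r r_def fin \<open>u \<notin> T\<close> by (simp add: scaleC_of_real)
    moreover have "c = (\<Sum>t\<in>insert u T. \<tau> (star t * c) *\<^sub>C t)" if "c \<in> B" for c
    proof -
      have "\<tau> (star u * c) = 0"
        by (subst expand[OF that]) (simp add: sum_distrib_left mult_scaleC_right u_orth)
      then show ?thesis using expand[OF that] fin \<open>u \<notin> T\<close> by simp
    qed
    ultimately show ?thesis
      using fin orth u_orth uu \<open>u \<notin> T\<close> by (intro exI[of _ "insert u T"]) (auto simp del: sum.insert)
  qed
qed

lemma orthonormal_basis:
  obtains T where "finite T" "\<And>x. x = (\<Sum>t\<in>T. \<tau> (star t * x) *\<^sub>C t)"
proof -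
  from finite_dimensional obtain B where
    "finite_dimensional_vector_space (scaleC :: complex \<Rightarrow> 'a \<Rightarrow> 'a) B" ..
  then interpret B: finite_dimensional_vector_space "scaleC :: complex \<Rightarrow> 'a \<Rightarrow> 'a" B .
  obtain T where T: "finite T" "\<And>b. b \<in> B \<Longrightarrow> b = (\<Sum>t\<in>T. \<tau> (star t * b) *\<^sub>C t)"
    using orthonormal_family[OF B.finite_Basis] by blast
  have "x = (\<Sum>t\<in>T. \<tau> (star t * x) *\<^sub>C t)" for x
  proof -
    have "x \<in> scaleC.span B" by (simp add: B.span_Basis)
    then show ?thesis
    proof (induction rule: scaleC.span_induct_alt)
      case base
      then show ?case by simp
    next
      case (step c b y)
      have "(\<Sum>t\<in>T. \<tau> (star t * (c *\<^sub>C b + y)) *\<^sub>C t)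
          = c *\<^sub>C (\<Sum>t\<in>T. \<tau> (star t * b) *\<^sub>C t) + (\<Sum>t\<in>T. \<tau> (star t * y) *\<^sub>C t)"
        by (simp add: distrib_left mult_scaleC_right scaleC.scale_left_distrib sum.distrib
            scaleC.scale_sum_right scaleC_scaleC)
      then show ?case using T(2)[OF step(1)] step(2) by simp
    qed
  qed
  then show thesis using T(1) that by blast
qed

text \<open>By Parseval, the square of the norm is a finite sum of squared moduli of the functionals
  \<open>x \<mapsto> \<tau> (star t * x)\<close>.\<close>

lemma weak_convergence_imp_norm2:
  assumes "\<And>w. (\<lambda>n. \<tau> (\<sigma> n * w)) \<longlonglongrightarrow> \<tau> (l * w)"
  shows "(\<lambda>n. norm2 (\<sigma> n - l)) \<longlonglongrightarrow> 0"
proof -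
  obtain T where T: "finite T" "\<And>x. x = (\<Sum>t\<in>T. \<tau> (star t * x) *\<^sub>C t)"
    using orthonormal_basis by blast
  have "(norm2 x)\<^sup>2 = (\<Sum>t\<in>T. (cmod (\<tau> (x * star t)))\<^sup>2)" for x
  proof -
    have "\<tau> (star x * x) = \<tau> (star x * (\<Sum>t\<in>T. \<tau> (star t * x) *\<^sub>C t))"
      using T(2)[of x] by simp
    also have "\<dots> = (\<Sum>t\<in>T. \<tau> (star t * x) * \<tau> (star x * t))"
      by (simp add: sum_distrib_left mult_scaleC_right)
    also have "\<dots> = (\<Sum>t\<in>T. of_real ((cmod (\<tau> (x * star t)))\<^sup>2))"
    proof (rule sum.cong)
      fix t
      have "\<tau> (star x * t) = cnj (\<tau> (star t * x))"
        using tau_star[of "star t * x"] by (simp add: star_mult)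
      then show "\<tau> (star t * x) * \<tau> (star x * t) = of_real ((cmod (\<tau> (x * star t)))\<^sup>2)"
        by (simp only: complex_norm_square tau_commute[of x])
    qed simp
    finally show ?thesis by (simp add: norm2_square)
  qed
  moreover have "(\<lambda>n. \<Sum>t\<in>T. (cmod (\<tau> ((\<sigma> n - l) * star t)))\<^sup>2) \<longlonglongrightarrow> (\<Sum>t\<in>T. (cmod 0)\<^sup>2)"
    using assms by (intro tendsto_intros) (simp add: left_diff_distrib LIM_zero_iff)
  ultimately have "(\<lambda>n. sqrt ((norm2 (\<sigma> n - l))\<^sup>2)) \<longlonglongrightarrow> sqrt 0"
    by (intro tendsto_real_sqrt) simp
  then show ?thesis by simp
qed

text \<open>The Fuchs--van de Graaf inequality gives one direction, the Powers--Stormer inequality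
  together with Parseval the other.\<close>

lemma bures_metric_tendsto_iff:
  assumes "\<And>n. \<sigma> n \<in> density_space \<tau>" "l \<in> density_space \<tau>"
  shows "(\<lambda>n. bures_metric \<tau> (\<sigma> n) l) \<longlonglongrightarrow> 0 \<longleftrightarrow> (\<forall>w. (\<lambda>n. \<tau> (\<sigma> n * w)) \<longlonglongrightarrow> \<tau> (l * w))"
proof
  assume lim: "(\<lambda>n. bures_metric \<tau> (\<sigma> n) l) \<longlonglongrightarrow> 0"
  show "\<forall>w. (\<lambda>n. \<tau> (\<sigma> n * w)) \<longlonglongrightarrow> \<tau> (l * w)"
  proof
    fix w :: 'a
    have "(\<lambda>n. 3 * (sqrt 2 * bures_metric \<tau> (\<sigma> n) l) * norm w) \<longlonglongrightarrow> 3 * (sqrt 2 * 0) * norm w"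
      by (intro tendsto_intros lim)
    then have "(\<lambda>n. 3 * (sqrt 2 * bures_metric \<tau> (\<sigma> n) l) * norm w) \<longlonglongrightarrow> 0" by simp
    moreover have "\<forall>n. norm (\<tau> (l * w) - \<tau> (\<sigma> n * w))
        \<le> 3 * (sqrt 2 * bures_metric \<tau> (\<sigma> n) l) * norm w"
      by (intro allI tau_diff_le_bures_metric assms)
    ultimately have "(\<lambda>n. \<tau> (l * w) - \<tau> (\<sigma> n * w)) \<longlonglongrightarrow> 0"
      by (rule Lim_null_comparison[OF always_eventually, rotated])
    then have "(\<lambda>n. \<tau> (l * w) - (\<tau> (l * w) - \<tau> (\<sigma> n * w))) \<longlonglongrightarrow> \<tau> (l * w) - 0"
      by (intro tendsto_diff tendsto_const)
    then show "(\<lambda>n. \<tau> (\<sigma> n * w)) \<longlonglongrightarrow> \<tau> (l * w)" by simp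
  qed
next
  assume "\<forall>w. (\<lambda>n. \<tau> (\<sigma> n * w)) \<longlonglongrightarrow> \<tau> (l * w)"
  then have "(\<lambda>n. norm2 (\<sigma> n - l)) \<longlonglongrightarrow> 0" by (intro weak_convergence_imp_norm2) simp
  then have "(\<lambda>n. sqrt (norm2 (\<sigma> n - l) * norm2 1 / 2)) \<longlonglongrightarrow> sqrt (0 * norm2 1 / 2)"
    by (intro tendsto_intros) simp_all
  then have "(\<lambda>n. sqrt (norm2 (\<sigma> n - l) * norm2 1 / 2)) \<longlonglongrightarrow> 0" by simp
  moreover have "\<forall>n. norm (bures_metric \<tau> (\<sigma> n) l) \<le> sqrt (norm2 (\<sigma> n - l) * norm2 1 / 2)"
  proof
    fix n
    have "(bures_metric \<tau> (\<sigma> n) l)\<^sup>2 \<le> norm2 (\<sigma> n - l) * norm2 1 / 2"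
      using bures_metric_le_norm2[OF assms(1)[of n] assms(2)] by simp
    then show "norm (bures_metric \<tau> (\<sigma> n) l) \<le> sqrt (norm2 (\<sigma> n - l) * norm2 1 / 2)"
      by (simp add: bures_metric_nonneg assms real_le_rsqrt)
  qed
  ultimately show "(\<lambda>n. bures_metric \<tau> (\<sigma> n) l) \<longlonglongrightarrow> 0"
    by (rule Lim_null_comparison[OF always_eventually, rotated])
qed

section \<open>The quantum metric\<close>

text \<open>Writing \<open>\<tau> (x * b) = \<tau> (a * (a * b))\<close> with \<open>a = \<surd>x\<close>, the Cauchy--Schwarz inequality bounds
  the norm of the functional by \<open>(norm2 a)\<^sup>2 = 1\<close>; the bound is attained at the unit.\<close>

lemma density_state_in_states:
  assumes "x \<in> density_space \<tau>"
  shows "density_state \<tau> x \<in> states"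
proof -
  define a where "a = cstar_sqrt x"
  note a = cstar_sqrt_density[OF assms, folded a_def]
  let ?\<phi> = "density_state \<tau> x"
  have lin: "Vector_Spaces.linear scaleC (*) ?\<phi>"
    unfolding Vector_Spaces.linear_iff using vector_space_scaleC
    by (auto simp: density_state_def distrib_left mult_scaleC_right
        intro: vector_space_over_itself.vector_space_axioms)
  have pos: "?\<phi> b \<in> \<real>\<^sub>\<ge>\<^sub>0" if "positive b" for b
    using tau_mult_positive[OF _ that, of x] assms by (simp add: density_state_def density_space_def)
  have bound: "norm (?\<phi> b) \<le> 1 * norm b" for b
  proof -
    have "?\<phi> b = \<tau> (star a * (a * b))"
      by (simp add: density_state_def a(1) flip: mult.assoc a(2))
    then have "norm (?\<phi> b) \<le> norm2 a * norm2 (a * b)" by (simp add: norm2_Cauchy_Schwarz)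
    also have "\<dots> \<le> 1 * norm b" using norm2_mult_right[of a b] by (simp add: a(3))
    finally show ?thesis .
  qed
  have "bounded_linear ?\<phi>"
    by (rule bounded_linear_intro[of _ 1])
      (use bound in \<open>auto simp: density_state_def distrib_left
          scaleR_conv_of_real[where 'a = complex] mult.commute\<close>)
  then have "norm (?\<phi> 1) / norm (1 :: 'a) \<le> onorm ?\<phi>" by (rule le_onorm)
  then have "1 \<le> onorm ?\<phi>" using assms by (simp add: density_state_def density_space_def)
  moreover have "onorm ?\<phi> \<le> 1" by (rule onorm_bound[OF _ bound]) simp
  ultimately show ?thesis
    using lin pos by (simp add: states_def positive_functional_def)
qed

end

lemma is_metric_onD:
  assumes "is_metric_on M d" "x \<in> M" "y \<in> M"
  shows "0 \<le> d x y" "d x y = d y x" "d x y = 0 \<longleftrightarrow> x = y" "z \<in> M \<Longrightarrow> d x z \<le> d x y + d y z"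
proof -
  interpret Metric_space M "dist_on M d" using assms(1) by (simp add: is_metric_on_def)
  show "0 \<le> d x y" "d x y = d y x" "d x y = 0 \<longleftrightarrow> x = y" "z \<in> M \<Longrightarrow> d x z \<le> d x y + d y z"
    using nonneg[of x y] commute[of x y] zero[of x y] triangle[of x y z] assms(2,3)
    by (simp_all add: dist_on_def)
qed

lemma is_metric_onI:
  assumes "\<And>x y. x \<in> M \<Longrightarrow> y \<in> M \<Longrightarrow> 0 \<le> d x y"
    and "\<And>x y. x \<in> M \<Longrightarrow> y \<in> M \<Longrightarrow> d x y = d y x"
    and "\<And>x y. x \<in> M \<Longrightarrow> y \<in> M \<Longrightarrow> d x y = 0 \<longleftrightarrow> x = y"
    and "\<And>x y z. x \<in> M \<Longrightarrow> y \<in> M \<Longrightarrow> z \<in> M \<Longrightarrow> d x z \<le> d x y + d y z"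
  shows "is_metric_on M d"
  unfolding is_metric_on_def by unfold_locales (use assms in \<open>auto simp: dist_on_def\<close>)

lemma limitin_metric_topology_on:
  assumes "is_metric_on M d" "\<And>n. \<sigma> n \<in> M" "l \<in> M"
  shows "limitin (metric_topology_on M d) \<sigma> l sequentially \<longleftrightarrow> (\<lambda>n. d (\<sigma> n) l) \<longlonglongrightarrow> 0"
proof -
  interpret Metric_space M "dist_on M d" using assms(1) by (simp add: is_metric_on_def)
  show ?thesis
    unfolding metric_topology_on_def limitin_metric_dist_null
    using assms(2,3) by (simp add: dist_on_def)
qed

text \<open>Metric topologies are determined by their convergent sequences.\<close>

lemma topologically_equivalentI:
  assumes d: "is_metric_on M d" "is_metric_on M d'"
    and "\<And>\<sigma> l. (\<And>n. \<sigma> n \<in> M) \<Longrightarrow> l \<in> M \<Longrightarrow>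
      (\<lambda>n. d (\<sigma> n) l) \<longlonglongrightarrow> 0 \<longleftrightarrow> (\<lambda>n. d' (\<sigma> n) l) \<longlonglongrightarrow> 0"
  shows "topologically_equivalent M d d'"
proof -
  interpret A: Metric_space M "dist_on M d" using d(1) by (simp add: is_metric_on_def)
  interpret B: Metric_space M "dist_on M d'" using d(2) by (simp add: is_metric_on_def)
  have "closedin A.mtopology S \<longleftrightarrow> closedin B.mtopology S" for S
  proof -
    have "limitin A.mtopology \<sigma> l sequentially \<longleftrightarrow> limitin B.mtopology \<sigma> l sequentially"
      if "range \<sigma> \<subseteq> S" "S \<subseteq> M" for \<sigma> l
      using limitin_metric_topology_on[OF d(1), of \<sigma> l] limitin_metric_topology_on[OF d(2), of \<sigma> l]
        assms(3)[of \<sigma> l] that limitin_topspace[of A.mtopology] limitin_topspace[of B.mtopology]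
      unfolding metric_topology_on_def
      by (metis A.topspace_mtopology B.topspace_mtopology rangeI subsetD)
    then show ?thesis
      unfolding A.metric_closedin_iff_sequentially_closed B.metric_closedin_iff_sequentially_closed
      by blast
  qed
  then have "A.mtopology = B.mtopology"
    by (metis A.topspace_mtopology B.topspace_mtopology topology_eq openin_closedin_eq)
  then show ?thesis by (simp add: topologically_equivalent_def d metric_topology_on_def)
qed

lemma tendsto_fun_iff: "(\<sigma> \<longlongrightarrow> l) F \<longleftrightarrow> (\<forall>i. ((\<lambda>n. \<sigma> n i) \<longlongrightarrow> l i) F)"
  for \<sigma> :: "'n \<Rightarrow> 'i \<Rightarrow> 'b::topological_space"
  using limitin_componentwise[of "\<lambda>_. euclidean" UNIV \<sigma> l F]
  by (simp add: euclidean_product_topology)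

text \<open>Convergence in the weak* topology is pointwise convergence, and by hypothesis the
  Monge--Kantorovich metric induces this topology.\<close>

lemma mk_dist_tendsto_iff:
  assumes "compact_quantum_metric_space L" "\<And>n. \<phi> n \<in> states" "\<psi> \<in> states"
  shows "(\<lambda>n. enn2real (mk_dist L (\<phi> n) \<psi>)) \<longlonglongrightarrow> 0 \<longleftrightarrow> (\<forall>a. (\<lambda>n. \<phi> n a) \<longlonglongrightarrow> \<psi> a)"
proof -
  have L: "is_metric_on states (\<lambda>\<phi> \<psi>. enn2real (mk_dist L \<phi> \<psi>))"
    "metric_topology_on states (\<lambda>\<phi> \<psi>. enn2real (mk_dist L \<phi> \<psi>)) = top_of_set states"
    using assms(1) by (simp_all add: compact_quantum_metric_space_def)
  show ?thesis
    using limitin_metric_topology_on[OF L(1) assms(2,3)] assms(2,3)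
    by (simp add: L(2) limitin_subtopology tendsto_fun_iff)
qed

theorem corollary3p6:
  fixes L :: "'a::cstar_algebra \<Rightarrow> ennreal" and \<tau> :: "'a \<Rightarrow> complex"
  assumes "compact_quantum_metric_space L"
    and "faithful_trace \<tau>"
    and "\<exists>B. finite_dimensional_vector_space (scaleC :: complex \<Rightarrow> 'a \<Rightarrow> 'a) B"
  shows "topologically_equivalent (density_space \<tau>) (bures_metric \<tau>) (quantum_metric L \<tau>)"
proof -
  interpret tracial_algebra \<tau> using assms(2,3) by unfold_locales
  have mk: "is_metric_on states (\<lambda>\<phi> \<psi>. enn2real (mk_dist L \<phi> \<psi>))"
    using assms(1) by (simp add: compact_quantum_metric_space_def)
  have inj: "density_state \<tau> x = density_state \<tau> y \<longleftrightarrow> x = y" for x y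
    using tau_mult_inject[of x y] by (auto simp: density_state_def fun_eq_iff)
  show ?thesis
  proof (rule topologically_equivalentI)
    show "is_metric_on (density_space \<tau>) (bures_metric \<tau>)"
      by (rule is_metric_onI)
        (simp_all add: bures_metric_nonneg bures_metric_eq_0_iff bures_metric_commute
          bures_metric_triangle)
    show "is_metric_on (density_space \<tau>) (quantum_metric L \<tau>)"
      unfolding quantum_metric_def
      by (rule is_metric_onI)
        (use is_metric_onD[OF mk] in \<open>simp_all add: density_state_in_states inj\<close>)
    show "(\<lambda>n. bures_metric \<tau> (\<sigma> n) l) \<longlonglongrightarrow> 0 \<longleftrightarrow> (\<lambda>n. quantum_metric L \<tau> (\<sigma> n) l) \<longlonglongrightarrow> 0"
      if "\<And>n. \<sigma> n \<in> density_space \<tau>" "l \<in> density_space \<tau>" for \<sigma> l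
      using that mk_dist_tendsto_iff[OF assms(1), of "\<lambda>n. density_state \<tau> (\<sigma> n)" "density_state \<tau> l"]
      by (simp add: bures_metric_tendsto_iff quantum_metric_def density_state_in_states)
        (simp add: density_state_def)
  qed
qed

end
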